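(* There exist absolute constants $C_0>0$ and $p>0$ such that the following holds. Let $\varepsilon>0$, let $q$ be a prime power, and let $\mathcal{C}'\subseteq\mathbb{F}_q^{n'}$ be a linear code of dimension $k\ge1$ with relative distance at least $1-\frac1q-\frac{\varepsilon^2}{2}$. Put $N=|\mathcal{C}'|=q^k$ and $L=2/\varepsilon^2$. Suppose that $n$ is a positive integer with $$n\ \ge\ \frac{C_0\,\log(N)\,\log^5(L)}{\min\{\varepsilon,\ q\varepsilon^2\}},$$ and let $\mathcal{C}\subseteq\mathbb{F}_q^n$ be a randomly sampled version of $\mathcal{C}'$ of block length $n$. Then, with probability at least $p$ over the choice of $\mathcal{C}$, the code $\mathcal{C}$ is $\left(1-\frac1q-\varepsilon',\ \frac{2}{\varepsilon^2}\right)$-list decodable, where $\varepsilon'=(2+\sqrt2)\,\varepsilon$.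
   Context: $d$ denotes relative Hamming distance on $\mathbb{F}_q^n$ (fraction of coordinates that differ); the relative distance of a code is the minimum of $d$ over pairs of distinct codewords. A code $\mathcal{C}\subseteq\mathbb{F}_q^n$ is $(\rho,\ell)$-list decodable if for every $z\in\mathbb{F}_q^n$ the number of codewords $c\in\mathcal{C}$ with $d(z,c)\le\rho$ is at most $\ell$. Randomly sampled version: if $\mathcal{C}'$ has generator matrix $G'\in\mathbb{F}_q^{k\times n'}$, form $G\in\mathbb{F}_q^{k\times n}$ whose $n$ columns are columns of $G'$ chosen independently and uniformly at random (with replacement); the randomly sampled version of $\mathcal{C}'$ of block length $n$ is $\mathcal{C}=\{x^TG : x\in\mathbb{F}_q^k\}$. $\log$ is the logarithm base $2$, and $\log^5(L)=(\log L)^5$. *)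

theory Defs
  imports
    "HOL-Probability.Probability"
    "HOL-Algebra.Algebra"
    "HOL-Library.FuncSet"
begin

text \<open>
  The alphabet is a finite field given by a ring record whose carrier is a set of natural numbers.
  Finite fields given as types would not do: types cannot be quantified inside a formula, so
  constants that are to be independent of the field could not be expressed. Working over
  type nat loses nothing, by the next lemma.
\<close>

lemma finite_field_iso_nat:
  fixes R :: "'a ring"
  assumes "field R" and fin: "finite (carrier R)"
  shows "\<exists>F :: nat ring. field F \<and> finite (carrier F) \<and> R \<simeq> F"
proof -
  interpret field R by fact
  obtain f :: "'a \<Rightarrow> nat" where f: "inj_on f (carrier R)"
    using fin finite_imp_inj_to_nat_seg by blast
  have "f \<in> ring_iso R (image_ring f R)"
    using inj_imp_image_ring_iso[OF f] .
  then have "R \<simeq> image_ring f R"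
    unfolding is_ring_iso_def by blast
  moreover have "finite (carrier (image_ring f R))"
    using fin by (simp add: image_ring_carrier)
  ultimately show ?thesis
    using inj_imp_image_ring_is_field[OF f] by blast
qed

text \<open>
  Vectors of length \<open>n\<close> are extensional functions on \<open>{..<n}\<close>, so that equality of vectors and
  cardinalities of codes are the ordinary ones. The multiplicative part of the record
  is irrelevant for a module.
\<close>

definition vec_module :: "nat ring \<Rightarrow> nat \<Rightarrow> (nat, nat \<Rightarrow> nat) module" where
  "vec_module F n =
    \<lparr>carrier = {..<n} \<rightarrow>\<^sub>E carrier F,
     mult = undefined, one = undefined,
     ring.zero = (\<lambda>i\<in>{..<n}. \<zero>\<^bsub>F\<^esub>),
     add = (\<lambda>x y. \<lambda>i\<in>{..<n}. x i \<oplus>\<^bsub>F\<^esub> y i),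
     smult = (\<lambda>a x. \<lambda>i\<in>{..<n}. a \<otimes>\<^bsub>F\<^esub> x i)\<rparr>"

lemma vec_module_is_module:
  assumes "field F"
  shows "module F (vec_module F n)"
proof -
  interpret field F by fact
  have mem: "x i \<in> carrier F" if "x \<in> carrier (vec_module F n)" "i < n" for x i
    using that unfolding vec_module_def by (simp add: PiE_iff)
  have out: "x i = undefined" if "x \<in> carrier (vec_module F n)" "\<not> i < n" for x i
    using that unfolding vec_module_def by (simp add: PiE_iff extensional_def)
  have add: "(x \<oplus>\<^bsub>vec_module F n\<^esub> y) i = (if i < n then x i \<oplus>\<^bsub>F\<^esub> y i else undefined)" for x y i
    by (simp add: vec_module_def)
  have zero: "\<zero>\<^bsub>vec_module F n\<^esub> i = (if i < n then \<zero>\<^bsub>F\<^esub> else undefined)" for i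
    by (simp add: vec_module_def)
  have smult: "(a \<odot>\<^bsub>vec_module F n\<^esub> x) i = (if i < n then a \<otimes>\<^bsub>F\<^esub> x i else undefined)" for a x i
    by (simp add: vec_module_def)
  have memI: "x \<in> carrier (vec_module F n)"
    if "\<And>i. i < n \<Longrightarrow> x i \<in> carrier F" "\<And>i. \<not> i < n \<Longrightarrow> x i = undefined" for x
    using that unfolding vec_module_def by (simp add: PiE_iff extensional_def)
  have grp: "abelian_group (vec_module F n)"
  proof (rule abelian_groupI)
    fix x y assume x: "x \<in> carrier (vec_module F n)" and y: "y \<in> carrier (vec_module F n)"
    show "x \<oplus>\<^bsub>vec_module F n\<^esub> y \<in> carrier (vec_module F n)"
      by (rule memI) (simp_all add: add mem x y)
    show "x \<oplus>\<^bsub>vec_module F n\<^esub> y = y \<oplus>\<^bsub>vec_module F n\<^esub> x"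
      by (rule ext) (simp add: add mem x y a_comm)
    fix z assume z: "z \<in> carrier (vec_module F n)"
    show "x \<oplus>\<^bsub>vec_module F n\<^esub> y \<oplus>\<^bsub>vec_module F n\<^esub> z =
        x \<oplus>\<^bsub>vec_module F n\<^esub> (y \<oplus>\<^bsub>vec_module F n\<^esub> z)"
      by (rule ext) (simp add: add mem x y z a_assoc)
  next
    show "\<zero>\<^bsub>vec_module F n\<^esub> \<in> carrier (vec_module F n)"
      by (rule memI) (simp_all add: zero)
  next
    fix x assume x: "x \<in> carrier (vec_module F n)"
    show "\<zero>\<^bsub>vec_module F n\<^esub> \<oplus>\<^bsub>vec_module F n\<^esub> x = x"
      by (rule ext) (simp add: add zero mem out x)
    let ?y = "\<lambda>i\<in>{..<n}. \<ominus>\<^bsub>F\<^esub> x i"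
    have "?y \<in> carrier (vec_module F n)"
      by (rule memI) (simp_all add: mem x)
    moreover have "?y \<oplus>\<^bsub>vec_module F n\<^esub> x = \<zero>\<^bsub>vec_module F n\<^esub>"
      by (rule ext) (simp add: add zero mem x l_neg)
    ultimately show "\<exists>y\<in>carrier (vec_module F n). y \<oplus>\<^bsub>vec_module F n\<^esub> x = \<zero>\<^bsub>vec_module F n\<^esub>"
      by blast
  qed
  show ?thesis
  proof (rule moduleI[OF is_cring grp])
    fix a x assume "a \<in> carrier F" "x \<in> carrier (vec_module F n)"
    then show "a \<odot>\<^bsub>vec_module F n\<^esub> x \<in> carrier (vec_module F n)"
      by (intro memI) (simp_all add: smult mem)
  qed (rule ext; simp add: smult add mem out l_distr r_distr m_assoc)+
qed

definition rel_dist :: "nat \<Rightarrow> (nat \<Rightarrow> nat) \<Rightarrow> (nat \<Rightarrow> nat) \<Rightarrow> real" where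
  "rel_dist n x y = real (card {i \<in> {..<n}. x i \<noteq> y i}) / real n"

text \<open>Only meaningful for finite codes with at least two codewords.\<close>

definition code_rel_dist :: "nat \<Rightarrow> (nat \<Rightarrow> nat) set \<Rightarrow> real" where
  "code_rel_dist n C = Min {rel_dist n x y | x y. x \<in> C \<and> y \<in> C \<and> x \<noteq> y}"

definition list_decodable ::
    "nat ring \<Rightarrow> nat \<Rightarrow> (nat \<Rightarrow> nat) set \<Rightarrow> real \<Rightarrow> real \<Rightarrow> bool" where
  "list_decodable F n C \<rho> l \<longleftrightarrow>
    (\<forall>z \<in> carrier (vec_module F n). real (card {c \<in> C. rel_dist n z c \<le> \<rho>}) \<le> l)"

text \<open>
  A \<open>k \<times> n\<close> matrix is a function \<open>G\<close> of which only the entries \<open>G i j\<close> with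
  \<open>i < k\<close> and \<open>j < n\<close> matter; \<open>vec_mat F k n x G\<close> is the product \<open>x\<^sup>T G\<close>.
\<close>

definition vec_mat ::
    "nat ring \<Rightarrow> nat \<Rightarrow> nat \<Rightarrow> (nat \<Rightarrow> nat) \<Rightarrow> (nat \<Rightarrow> nat \<Rightarrow> nat) \<Rightarrow> nat \<Rightarrow> nat" where
  "vec_mat F k n x G = (\<lambda>j\<in>{..<n}. \<Oplus>\<^bsub>F\<^esub>i\<in>{..<k}. x i \<otimes>\<^bsub>F\<^esub> G i j)"

definition row_space ::
    "nat ring \<Rightarrow> nat \<Rightarrow> nat \<Rightarrow> (nat \<Rightarrow> nat \<Rightarrow> nat) \<Rightarrow> (nat \<Rightarrow> nat) set" where
  "row_space F k n G = (\<lambda>x. vec_mat F k n x G) ` carrier (vec_module F k)"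

text \<open>The \<open>k\<close> rows of \<open>G\<close> form a basis of \<open>C\<close>: they are linearly independent and span \<open>C\<close>.\<close>

definition generator_matrix ::
    "nat ring \<Rightarrow> nat \<Rightarrow> nat \<Rightarrow> (nat \<Rightarrow> nat \<Rightarrow> nat) \<Rightarrow> (nat \<Rightarrow> nat) set \<Rightarrow> bool" where
  "generator_matrix F k n G C \<longleftrightarrow>
    (\<forall>i<k. \<forall>j<n. G i j \<in> carrier F) \<and>
    (\<forall>x \<in> carrier (vec_module F k).
       vec_mat F k n x G = \<zero>\<^bsub>vec_module F n\<^esub> \<longrightarrow> x = \<zero>\<^bsub>vec_module F k\<^esub>) \<and>
    C = row_space F k n G"

text \<open>A linear code of dimension \<open>k\<close> is a subspace that has a basis of \<open>k\<close> vectors.\<close>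

definition linear_code :: "nat ring \<Rightarrow> nat \<Rightarrow> nat \<Rightarrow> (nat \<Rightarrow> nat) set \<Rightarrow> bool" where
  "linear_code F n k C \<longleftrightarrow>
    submodule C F (vec_module F n) \<and> (\<exists>G. generator_matrix F k n G C)"

text \<open>
  The column indices \<open>J 0, \<dots>, J (n - 1)\<close> are independent and uniform in \<open>{..<n'}\<close>; column \<open>j\<close>
  of the sampled matrix is column \<open>J j\<close> of \<open>G'\<close>. The default value \<open>0\<close> of the product
  distribution concerns only the arguments outside \<open>{..<n}\<close>, which are not used.
\<close>

definition sampled_code ::
    "nat ring \<Rightarrow> nat \<Rightarrow> nat \<Rightarrow> (nat \<Rightarrow> nat \<Rightarrow> nat) \<Rightarrow> nat \<Rightarrow> (nat \<Rightarrow> nat) set pmf" where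
  "sampled_code F k n' G' n =
    map_pmf (\<lambda>J. row_space F k n (\<lambda>i j. G' i (J j)))
      (Pi_pmf {..<n} 0 (\<lambda>_. pmf_of_set {..<n'}))"

end

theory Submission
  imports Defs
begin

text \<open>
  If the sampled code is not list decodable, then some \<open>M > 2/\<epsilon>\<^sup>2\<close> codewords of \<open>C'\<close> agree with a common
  word too often, so the sum over the sampled columns of the plurality of the list \<open>\<sigma>\<close> (the largest
  multiplicity of a symbol in the column, divided by \<open>M\<close>) is at least \<open>n (1/q + (2 + sqrt 2) \<epsilon>)\<close>. By a
  second moment computation the distance of \<open>C'\<close> bounds its mean by \<open>n (1/q + \<epsilon>)\<close>. A union bound over
  all \<open>N\<^sup>M\<close> lists is too expensive, and is replaced by chaining. The plurality of \<open>\<sigma>\<close> is approximated by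
  truncated pluralities of random sublists of sizes \<open>1, 2, 4, \<dots>, 2\<^sup>T \<approx> M\<close>, where the squared error at
  size \<open>2\<^sup>t\<close> is \<open>O(log M / 2\<^sup>t)\<close> times the plurality itself. There are at most \<open>N\<close> to the power \<open>3 \<cdot> 2\<^sup>t\<close>
  links between levels \<open>t\<close> and \<open>t + 1\<close>, so each level contributes \<open>O(ln N / \<lambda> + \<lambda> log M \<cdot> S)\<close> to the
  deviation, where \<open>S\<close> is the total plurality plus its mean. With \<open>\<lambda>\<close> such that the factor of \<open>S\<close>, summed
  over the levels, is \<open>min(1, q \<epsilon>)/10\<close>, the deviation is less than \<open>(1 + sqrt 2) \<epsilon> n\<close>.
\<close>

subsection \<open>Self-normalised deviations\<close>

text \<open>For negative \<open>x\<close> put \<open>y = - x\<close>. The Taylor lower bound for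
  \<open>exp y\<close> times \<open>1 - y + y^2\<close> is 1 plus nonnegative terms, so
  \<open>exp y\<close> can be inverted.\<close>

lemma exp_le_quadratic:
  fixes x :: real
  assumes "x \<le> 1"
  shows "exp x \<le> 1 + x + x\<^sup>2"
proof (cases "0 \<le> x")
  case True
  then show ?thesis using assms by (rule exp_bound)
next
  case False
  define y where "y = - x"
  have y: "0 < y" using False by (simp add: y_def)
  have low: "1 + y + y\<^sup>2 / 2 \<le> exp y"
    using exp_lower_Taylor_quadratic[of y] y by simp
  have pos: "0 \<le> 1 - y + y\<^sup>2"
    using zero_le_power2[of "y - 1"] y by (simp add: power2_eq_square algebra_simps)
  have "1 \<le> (1 + y + y\<^sup>2 / 2) * (1 - y + y\<^sup>2)"
  proof -
    have "(1 + y + y\<^sup>2 / 2) * (1 - y + y\<^sup>2) = 1 + y\<^sup>2 / 2 + y ^ 3 / 2 + y ^ 4 / 2"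
      by (simp add: field_simps power2_eq_square power3_eq_cube power4_eq_xxxx)
    then show ?thesis using y by simp
  qed
  also have "\<dots> \<le> exp y * (1 - y + y\<^sup>2)"
    using low pos by (rule mult_right_mono)
  finally have "inverse (exp y) \<le> 1 - y + y\<^sup>2"
    by (simp add: field_simps)
  then show ?thesis by (simp add: y_def exp_minus)
qed

text \<open>There is no upper limit on \<open>x\<close>: up to 1 the quadratic bound on
  \<open>exp\<close> applies, and beyond 1 the square outweighs \<open>x\<close>, so that the left
  side is at most 1.\<close>

lemma exp_minus_square_le:
  fixes x :: real
  shows "exp (x - x\<^sup>2) \<le> 1 + x + x\<^sup>2"
proof (cases "x \<le> 1")
  case True
  have "exp (x - x\<^sup>2) \<le> exp x" by simp
  then show ?thesis using exp_le_quadratic[OF True] by linarith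
next
  case False
  have "x * 1 \<le> x * x" using False by (intro mult_left_mono) auto
  then have "exp (x - x\<^sup>2) \<le> 1" by (simp add: power2_eq_square)
  then show ?thesis using False by (smt (verit) zero_le_power2)
qed

text \<open>Turns the second moment of an upper tail into an exponential moment, which factorises
  over independent draws. The rate \<open>l\<close> stays free, to be tuned to the scale of the
  fluctuation.\<close>

lemma square_le_exp:
  fixes y l :: real
  assumes "0 < l"
  shows "(max 0 y)\<^sup>2 \<le> 2 / l\<^sup>2 * exp (l * y)"
proof (cases "0 \<le> y")
  case True
  have "1 + l * y + (l * y)\<^sup>2 / 2 \<le> exp (l * y)"
    using exp_lower_Taylor_quadratic[of "l * y"] assms True by simp
  moreover have "0 \<le> l * y" using assms True by simp
  ultimately have "(l * y)\<^sup>2 / 2 \<le> exp (l * y)" by linarith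
  then show ?thesis using assms True by (simp add: field_simps power_mult_distrib)
next
  case False
  then show ?thesis by simp
qed

lemma integrable_Pi_pmf_finite:
  fixes f :: "_ \<Rightarrow> real"
  assumes "finite A" "finite (set_pmf p)"
  shows "integrable (measure_pmf (Pi_pmf A d (\<lambda>_. p))) f"
  using assms
  by (intro integrable_measure_pmf_finite) (auto simp: set_Pi_pmf intro!: finite_PiE_dflt)

lemma expectation_exp_sum_Pi_pmf:
  fixes f :: "'a \<Rightarrow> real"
  assumes A: "finite A" and p: "finite (set_pmf p)"
    and le: "measure_pmf.expectation p (\<lambda>u. exp (f u)) \<le> exp b"
  shows "measure_pmf.expectation (Pi_pmf A d (\<lambda>_. p)) (\<lambda>J. exp (\<Sum>j\<in>A. f (J j)))
    \<le> exp (real (card A) * b)"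
proof -
  have "measure_pmf.expectation (Pi_pmf A d (\<lambda>_. p)) (\<lambda>J. exp (\<Sum>j\<in>A. f (J j)))
      = (\<Prod>j\<in>A. measure_pmf.expectation p (\<lambda>u. exp (f u)))"
    using A p expectation_prod_Pi_pmf[where f = "\<lambda>_ u. exp (f u)" and A = A and p = "\<lambda>_. p" and dflt = d]
    by (simp add: exp_sum integrable_measure_pmf_finite)
  also have "\<dots> = measure_pmf.expectation p (\<lambda>u. exp (f u)) ^ card A"
    by simp
  also have "\<dots> \<le> exp b ^ card A"
    using le by (intro power_mono) simp_all
  finally show ?thesis by (simp add: exp_of_nat_mult)
qed

text \<open>
  The subtracted square makes a bound on the size of \<open>Y\<close> unnecessary. This is what lets every link of
  the chain below be controlled by its second moment alone, where Bernstein's inequality would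
  lose a factor for the rare columns with a large plurality.
\<close>

lemma expectation_exp_self_normalized:
  fixes Y :: "'a \<Rightarrow> real"
  assumes p: "finite (set_pmf p)"
  shows "measure_pmf.expectation p (\<lambda>u. exp (Y u - (Y u)\<^sup>2))
    \<le> exp (measure_pmf.expectation p Y + measure_pmf.expectation p (\<lambda>u. (Y u)\<^sup>2))"
proof -
  note int = integrable_measure_pmf_finite[OF p]
  have "measure_pmf.expectation p (\<lambda>u. exp (Y u - (Y u)\<^sup>2))
      \<le> measure_pmf.expectation p (\<lambda>u. 1 + Y u + (Y u)\<^sup>2)"
    by (intro integral_mono int exp_minus_square_le)
  also have "\<dots> = 1 + (measure_pmf.expectation p Y + measure_pmf.expectation p (\<lambda>u. (Y u)\<^sup>2))"
    by (simp add: int)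
  finally show ?thesis using exp_ge_add_one_self by (rule order_trans)
qed

text \<open>Markov's inequality for the exponential of the sum; by independence the bound for one
  draw is raised to the power \<open>card A\<close>.\<close>

lemma prob_self_normalized_sum_le:
  fixes Y :: "'a \<Rightarrow> real"
  assumes A: "finite A" and p: "finite (set_pmf p)"
  shows "measure_pmf.prob (Pi_pmf A d (\<lambda>_. p))
      {J. real (card A) * (measure_pmf.expectation p Y + measure_pmf.expectation p (\<lambda>u. (Y u)\<^sup>2)) + s
          \<le> (\<Sum>j\<in>A. Y (J j) - (Y (J j))\<^sup>2)} \<le> exp (- s)"
    (is "measure_pmf.prob ?P {J. ?b + s \<le> ?S J} \<le> _")
proof -
  have "measure_pmf.prob ?P {J. ?b + s \<le> ?S J}
      = measure_pmf.prob ?P {J \<in> space (measure_pmf ?P). exp (?b + s) \<le> exp (?S J)}"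
    by simp
  also have "\<dots> \<le> measure_pmf.expectation ?P (\<lambda>J. exp (?S J)) / exp (?b + s)"
    by (intro integral_Markov_inequality_measure[of _ _ UNIV] integrable_Pi_pmf_finite A p) simp_all
  also have "\<dots> \<le> exp ?b / exp (?b + s)"
    by (intro divide_right_mono expectation_exp_sum_Pi_pmf A p expectation_exp_self_normalized) simp
  also have "\<dots> = exp (- s)"
    by (simp add: exp_diff[symmetric])
  finally show ?thesis .
qed

text \<open>Union bound. The slack \<open>s\<close> depends on the index so that larger groups of
  links can be charged more.\<close>

lemma prob_self_normalized_family:
  fixes Y :: "'i \<Rightarrow> 'a \<Rightarrow> real"
  assumes A: "finite A" and p: "finite (set_pmf p)" and I: "finite I"
    and s: "(\<Sum>i\<in>I. exp (- s i)) \<le> \<delta>"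
  shows "1 - \<delta> \<le> measure_pmf.prob (Pi_pmf A d (\<lambda>_. p))
      {J. \<forall>i\<in>I. (\<Sum>j\<in>A. Y i (J j) - (Y i (J j))\<^sup>2)
        < real (card A) * (measure_pmf.expectation p (Y i)
            + measure_pmf.expectation p (\<lambda>u. (Y i u)\<^sup>2)) + s i}"
    (is "_ \<le> measure_pmf.prob ?P {J. \<forall>i\<in>I. ?S i J < ?b i}")
proof -
  have "measure_pmf.prob ?P (\<Union>i\<in>I. {J. ?b i \<le> ?S i J})
      \<le> (\<Sum>i\<in>I. measure_pmf.prob ?P {J. ?b i \<le> ?S i J})"
    by (intro measure_pmf.finite_measure_subadditive_finite I) simp
  also have "\<dots> \<le> (\<Sum>i\<in>I. exp (- s i))"
    by (intro sum_mono prob_self_normalized_sum_le A p)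
  finally have "measure_pmf.prob ?P (\<Union>i\<in>I. {J. ?b i \<le> ?S i J}) \<le> \<delta>"
    using s by linarith
  moreover have "measure_pmf.prob ?P (- (\<Union>i\<in>I. {J. ?b i \<le> ?S i J}))
      = 1 - measure_pmf.prob ?P (\<Union>i\<in>I. {J. ?b i \<le> ?S i J})"
    by (subst measure_pmf.prob_compl[symmetric]) (simp_all add: Compl_eq_Diff_UNIV)
  moreover have "- (\<Union>i\<in>I. {J. ?b i \<le> ?S i J}) = {J. \<forall>i\<in>I. ?S i J < ?b i}"
    by (auto simp: not_le)
  ultimately show ?thesis by simp
qed

text \<open>The condition \<open>l \<le> 1\<close> admits negative \<open>l\<close>, so this serves
  both the upper and the lower tail of a count.\<close>

lemma expectation_exp_card_Pi_pmf:
  assumes A: "finite A" and p: "finite (set_pmf p)" and l: "l \<le> 1"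
  shows "measure_pmf.expectation (Pi_pmf A d (\<lambda>_. p)) (\<lambda>J. exp (l * real (card {j \<in> A. J j \<in> S})))
    \<le> exp (real (card A) * (measure_pmf.prob p S * (l + l\<^sup>2)))"
proof -
  note int = integrable_measure_pmf_finite[OF p]
  have "measure_pmf.expectation p (\<lambda>u. exp (l * indicator S u))
      \<le> measure_pmf.expectation p (\<lambda>u. 1 + (l + l\<^sup>2) * indicator S u)"
    using exp_le_quadratic[OF l] by (intro integral_mono int) (simp split: split_indicator)
  also have "\<dots> = 1 + measure_pmf.prob p S * (l + l\<^sup>2)"
    by (simp add: int)
  also have "\<dots> \<le> exp (measure_pmf.prob p S * (l + l\<^sup>2))"
    by (rule exp_ge_add_one_self)
  finally have "measure_pmf.expectation p (\<lambda>u. exp (l * indicator S u))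
      \<le> exp (measure_pmf.prob p S * (l + l\<^sup>2))" .
  from expectation_exp_sum_Pi_pmf[OF A p this, of d]
  have "measure_pmf.expectation (Pi_pmf A d (\<lambda>_. p)) (\<lambda>J. exp (\<Sum>j\<in>A. l * indicator S (J j)))
    \<le> exp (real (card A) * (measure_pmf.prob p S * (l + l\<^sup>2)))" .
  moreover have "(\<Sum>j\<in>A. l * indicator S (J j)) = l * real (card {j \<in> A. J j \<in> S})" for J
    using A by (simp add: sum_distrib_left[symmetric] indicator_def sum.If_cases Int_def)
  ultimately show ?thesis by simp
qed

subsection \<open>Plurality of a random sublist\<close>

text \<open>The maximum runs over the symbols that occur, so the alphabet may be infinite. For
  \<open>m = 0\<close> it is the maximum of an empty set, which is why most facts about it assume
  \<open>0 < m\<close>.\<close>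

definition plurality :: "nat \<Rightarrow> (nat \<Rightarrow> 'a) \<Rightarrow> nat" where
  "plurality m g = Max ((\<lambda>a. card {i \<in> {..<m}. g i = a}) ` g ` {..<m})"

lemma card_le_plurality:
  assumes "0 < m"
  shows "card {i \<in> {..<m}. g i = a} \<le> plurality m g"
proof (cases "a \<in> g ` {..<m}")
  case True
  then show ?thesis unfolding plurality_def by (intro Max_ge) auto
next
  case False
  then have "{i \<in> {..<m}. g i = a} = {}" by auto
  then show ?thesis by (metis card.empty le0)
qed

lemma plurality_attained:
  assumes "0 < m"
  obtains i where "i < m" "plurality m g = card {k \<in> {..<m}. g k = g i}"
proof -
  have "plurality m g \<in> (\<lambda>a. card {i \<in> {..<m}. g i = a}) ` g ` {..<m}"
    unfolding plurality_def using assms by (intro Max_in) auto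
  then show thesis using that by auto
qed

lemma plurality_pos:
  assumes "0 < m"
  shows "1 \<le> plurality m g"
proof -
  have "1 \<le> card {i \<in> {..<m}. g i = g 0}"
    using assms by (simp add: Suc_le_eq card_gt_0_iff) blast
  also have "\<dots> \<le> plurality m g" by (rule card_le_plurality[OF assms])
  finally show ?thesis .
qed

lemma plurality_le:
  assumes "0 < m"
  shows "plurality m g \<le> m"
proof -
  obtain i where i: "plurality m g = card {k \<in> {..<m}. g k = g i}"
    using plurality_attained[OF assms] .
  also have "\<dots> \<le> card {..<m}" by (intro card_mono) auto
  finally show ?thesis by simp
qed

lemma plurality_cong:
  assumes "\<And>i. i < m \<Longrightarrow> g i = h i"
  shows "plurality m g = plurality m h"
proof -
  have "g ` {..<m} = h ` {..<m}" using assms by auto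
  moreover have "{i \<in> {..<m}. g i = a} = {i \<in> {..<m}. h i = a}" for a using assms by auto
  ultimately show ?thesis unfolding plurality_def by simp
qed

lemma integral_pmf_mono_set:
  fixes f g :: "'a \<Rightarrow> real"
  assumes "finite (set_pmf P)" "\<And>x. x \<in> set_pmf P \<Longrightarrow> f x \<le> g x"
  shows "measure_pmf.expectation P f \<le> measure_pmf.expectation P g"
  using assms by (intro integral_mono_AE integrable_measure_pmf_finite) (auto simp: AE_measure_pmf_iff)

text \<open>\<open>A\<close> is the expected count of a most frequent symbol of \<open>g\<close>
  among \<open>m\<close> draws. The point is that the error is linear in \<open>A\<close> even when
  \<open>A\<close> is far below 1.\<close>

lemma sample_plurality_truncated:
  fixes g :: "nat \<Rightarrow> 'a"
  assumes M: "2 \<le> M" and m: "1 \<le> m"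
  defines "th \<equiv> 8 * ln (real M)" and "A \<equiv> real m * real (plurality M g) / real M"
  shows "measure_pmf.expectation (Pi_pmf {..<m} d (\<lambda>_. pmf_of_set {..<M}))
      (\<lambda>\<iota>. (max 0 (real (plurality m (\<lambda>i. g (\<iota> i))) - th) - A)\<^sup>2) \<le> (10 * th + 16) * A"
proof -
  define p where "p = pmf_of_set {..<M}"
  define P where "P = Pi_pmf {..<m} d (\<lambda>_. p)"
  define Y where "Y a \<iota> = real (card {i \<in> {..<m}. \<iota> i \<in> {k. g k = a}})" for a \<iota>
  define S where "S = g ` {..<M}"
  define F where "F \<iota> = max 0 (real (plurality m (\<lambda>i. g (\<iota> i))) - th)" for \<iota>
  have M0: "{..<M} \<noteq> {}" "0 < M" using M by (auto simp: lessThan_empty_iff)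
  have sp: "set_pmf p = {..<M}" unfolding p_def using M0 by simp
  have finp: "finite (set_pmf p)" by (simp add: sp)
  have sP: "set_pmf P = PiE_dflt {..<m} d (\<lambda>_. {..<M})"
    unfolding P_def by (simp add: set_Pi_pmf sp o_def)
  have finP: "finite (set_pmf P)" unfolding sP by (intro finite_PiE_dflt) auto
  note int = integrable_measure_pmf_finite[OF finP]
  have finS: "finite S" and cardS: "card S \<le> M"
    unfolding S_def using card_image_le[of "{..<M}" g] by auto
  have prob: "measure_pmf.prob p {k. g k = a} = card {k \<in> {..<M}. g k = a} / M" for a
    unfolding p_def using M0 by (simp add: measure_pmf_of_set Int_def)
  have lnM: "1 / 8 \<le> ln (real M)"
  proof -
    have "2 / 3 \<le> ln (2::real)" by (rule ln2_ge_two_thirds)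
    also have "\<dots> \<le> ln (real M)" using M by simp
    finally show ?thesis by simp
  qed
  then have th1: "1 \<le> th" by (simp add: th_def)
  \<comment> \<open>This lets errors of order \<open>1 / M\<close> be absorbed into a multiple of
    \<open>A\<close>.\<close>
  have A1: "1 / real M \<le> A"
  proof -
    have "1 * 1 \<le> real m * real (plurality M g)"
      using m plurality_pos[OF M0(2), of g] by (intro mult_mono) auto
    then show ?thesis unfolding A_def by (intro divide_right_mono) auto
  qed
  have A0: "0 < A" using A1 M0 by (smt (verit) divide_pos_pos of_nat_0_less_iff)
  have mgf: "measure_pmf.expectation P (\<lambda>\<iota>. exp (l * Y a \<iota>)) \<le> exp (A * (l + l\<^sup>2))"
    if "0 \<le> l" "l \<le> 1" for l a
  proof -
    have "measure_pmf.expectation P (\<lambda>\<iota>. exp (l * Y a \<iota>))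
        \<le> exp (real m * (card {k \<in> {..<M}. g k = a} / M * (l + l\<^sup>2)))"
      using expectation_exp_card_Pi_pmf[of "{..<m}" p l d "{k. g k = a}"] finp that(2)
      unfolding P_def Y_def prob by simp
    also have "\<dots> = exp (real m * card {k \<in> {..<M}. g k = a} / M * (l + l\<^sup>2))" by simp
    also have "\<dots> \<le> exp (A * (l + l\<^sup>2))"
      unfolding A_def using that card_le_plurality[OF M0(2), of g a]
      by (intro exp_mono mult_right_mono divide_right_mono mult_left_mono) auto
    finally show ?thesis .
  qed
  \<comment> \<open>A single most frequent symbol controls the lower tail, because the plurality of
    the sample is at least its count. The upper tail involves all symbols.\<close>
  obtain i0 where i0: "i0 < M" "plurality M g = card {k \<in> {..<M}. g k = g i0}"
    using plurality_attained[OF M0(2)] .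
  define c where "c = g i0"
  have mgf': "measure_pmf.expectation P (\<lambda>\<iota>. exp (- l * Y c \<iota>)) \<le> exp (A * (- l + l\<^sup>2))"
    if "0 \<le> l" for l
  proof -
    have "measure_pmf.expectation P (\<lambda>\<iota>. exp (- l * Y c \<iota>))
        \<le> exp (real m * (card {k \<in> {..<M}. g k = c} / M * (- l + (- l)\<^sup>2)))"
      using expectation_exp_card_Pi_pmf[of "{..<m}" p "- l" d "{k. g k = c}"] finp that
      unfolding P_def Y_def prob by simp
    also have "\<dots> = exp (A * (- l + l\<^sup>2))"
      unfolding A_def i0(2) c_def by simp
    finally show ?thesis .
  qed
  have top: "\<exists>b\<in>S. real (plurality m (\<lambda>i. g (\<iota> i))) = Y b \<iota>" if \<iota>: "\<iota> \<in> set_pmf P" for \<iota>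
  proof -
    obtain i where i: "i < m" "plurality m (\<lambda>i. g (\<iota> i)) = card {k \<in> {..<m}. g (\<iota> k) = g (\<iota> i)}"
      using plurality_attained[of m "\<lambda>i. g (\<iota> i)"] m by auto
    have "g (\<iota> i) \<in> S" using \<iota> i unfolding sP S_def PiE_dflt_def by auto
    then show ?thesis using i(2) unfolding Y_def by auto
  qed
  have bot: "Y c \<iota> \<le> real (plurality m (\<lambda>i. g (\<iota> i)))" for \<iota>
    using card_le_plurality[of m "\<lambda>i. g (\<iota> i)" c] m unfolding Y_def by simp
  have "measure_pmf.expectation P (\<lambda>\<iota>. (F \<iota> - A)\<^sup>2) \<le> (10 * th + 16) * A"
    \<comment> \<open>For small \<open>A\<close> the truncation absorbs the upper fluctuations of all symbols; for large \<open>A\<close>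
      these are of the order \<open>sqrt (th * A)\<close>.\<close>
  proof (cases "A \<le> th")
    case True
    \<comment> \<open>Below \<open>A\<close> the error is at most \<open>A\<close>, whose square is
      at most \<open>th * A\<close>. Above \<open>A\<close> it is the excess of some count over
      \<open>th + A\<close>, bounded exponentially at rate \<open>1/2\<close>.\<close>
    have "(F \<iota> - A)\<^sup>2 \<le> th * A + (\<Sum>a\<in>S. 8 * exp (- (th + A) / 2) * exp (1/2 * Y a \<iota>))"
      if \<iota>: "\<iota> \<in> set_pmf P" for \<iota>
    proof -
      obtain b where b: "b \<in> S" "real (plurality m (\<lambda>i. g (\<iota> i))) = Y b \<iota>" using top[OF \<iota>] by auto
      have "(F \<iota> - A)\<^sup>2 \<le> th * A + (max 0 (Y b \<iota> - th - A))\<^sup>2"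
      proof (cases "F \<iota> \<le> A")
        case le: True
        have "(A - F \<iota>)\<^sup>2 \<le> A\<^sup>2" using le by (intro power_mono) (auto simp: F_def)
        also have "\<dots> \<le> th * A" using True A0 by (simp add: power2_eq_square)
        finally show ?thesis by (simp add: power2_commute add_increasing2)
      next
        case False
        then have "F \<iota> - A = max 0 (Y b \<iota> - th - A)" using A0 b(2) unfolding F_def by auto
        then show ?thesis using th1 A0 by simp
      qed
      also have "(max 0 (Y b \<iota> - th - A))\<^sup>2 \<le> 2 / (1/2)\<^sup>2 * exp (1/2 * (Y b \<iota> - th - A))"
        by (rule square_le_exp) simp
      also have "\<dots> = 8 * exp (- (th + A) / 2) * exp (1/2 * Y b \<iota>)"
        by (simp add: mult_exp_exp power2_eq_square field_simps)
      also have "\<dots> \<le> (\<Sum>a\<in>S. 8 * exp (- (th + A) / 2) * exp (1/2 * Y a \<iota>))"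
        using b(1) finS by (intro member_le_sum) auto
      finally show ?thesis by simp
    qed
    then have "measure_pmf.expectation P (\<lambda>\<iota>. (F \<iota> - A)\<^sup>2)
        \<le> measure_pmf.expectation P (\<lambda>\<iota>. th * A + (\<Sum>a\<in>S. 8 * exp (- (th + A) / 2) * exp (1/2 * Y a \<iota>)))"
      by (intro integral_pmf_mono_set finP)
    also have "\<dots> = th * A + (\<Sum>a\<in>S. 8 * exp (- (th + A) / 2) *
        measure_pmf.expectation P (\<lambda>\<iota>. exp (1/2 * Y a \<iota>)))"
      by (simp add: int)
    also have "\<dots> \<le> th * A + (\<Sum>a\<in>S. 8 * exp (- (th + A) / 2) * exp (A * (1/2 + (1/2)\<^sup>2)))"
      by (intro add_left_mono sum_mono mult_left_mono mgf) auto
    also have "(\<Sum>a\<in>S. 8 * exp (- (th + A) / 2) * exp (A * (1/2 + (1/2)\<^sup>2)))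
        = 8 * (real (card S) * exp (A / 4 - th / 2))"
      by (simp add: mult_exp_exp power2_eq_square field_simps)
    also have "\<dots> \<le> 8 * (real M * exp (- (th / 4)))"
      using cardS True by (intro mult_left_mono mult_mono exp_mono) auto
    \<comment> \<open>Here the factor 8 in \<open>th\<close> enters: of the two factors
      \<open>1 / M\<close>, one pays for the at most \<open>M\<close> symbols and the other is
      bounded by \<open>A\<close>.\<close>
    also have "exp (- (th / 4)) = 1 / real M / real M"
      using M0 exp_of_nat_mult[of 2 "ln (real M)"]
      by (simp add: th_def exp_minus power2_eq_square field_simps)
    also have "8 * (real M * (1 / real M / real M)) = 8 * (1 / real M)"
      using M0 by simp
    also have "\<dots> \<le> 8 * A" using A1 by simp
    finally have "measure_pmf.expectation P (\<lambda>\<iota>. (F \<iota> - A)\<^sup>2) \<le> th * A + 8 * A" by simp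
    also have "\<dots> \<le> (10 * th + 16) * A" using th1 A0 by (simp add: algebra_simps)
    finally show ?thesis .
  next
    case False
    \<comment> \<open>The rates balance the quadratic terms of the exponents. For the upper tail
      \<open>A * l^2 = th\<close> and \<open>l * s = 2 * th\<close> leave \<open>exp (- th)\<close>
      per symbol, which outweighs the number of symbols. The lower tail concerns only
      \<open>c\<close>, so \<open>A * l'^2 = 1\<close> and a constant factor suffice.\<close>
    define s where "s = 2 * sqrt (th * A)"
    define l where "l = sqrt (th / A)"
    define l' where "l' = 1 / sqrt A"
    have l: "0 < l" "l \<le> 1" "l\<^sup>2 = th / A" "l * s = 2 * th" "s\<^sup>2 = 4 * (th * A)"
    proof -
      show "0 < l" "l \<le> 1" "l\<^sup>2 = th / A" using False th1 A0 by (simp_all add: l_def)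
      show "s\<^sup>2 = 4 * (th * A)" using th1 A0 by (simp add: s_def power_mult_distrib)
      have "l * s = 2 * (sqrt (th / A) * sqrt (th * A))" by (simp add: l_def s_def)
      also have "\<dots> = 2 * sqrt (th\<^sup>2)"
        using A0 by (simp add: real_sqrt_mult[symmetric] power2_eq_square)
      finally show "l * s = 2 * th" using th1 by simp
    qed
    have l': "0 < l'" "l'\<^sup>2 = 1 / A" using A0 by (simp_all add: l'_def power_divide)
    define K1 where "K1 = 4 * A / th * exp (- (l * A) - 2 * th)"
    define K2 where "K2 = 4 * A * exp (l' * A)"
    have K: "0 \<le> K1" "0 \<le> K2" using A0 th1 by (simp_all add: K1_def K2_def)
    have "(F \<iota> - A)\<^sup>2 \<le> 10 * th * A + (\<Sum>a\<in>S. K1 * exp (l * Y a \<iota>)) + K2 * exp (- l' * Y c \<iota>)"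
      if \<iota>: "\<iota> \<in> set_pmf P" for \<iota>
    proof -
      obtain b where b: "b \<in> S" "real (plurality m (\<lambda>i. g (\<iota> i))) = Y b \<iota>" using top[OF \<iota>] by auto
      have sum0: "0 \<le> (\<Sum>a\<in>S. K1 * exp (l * Y a \<iota>))" using K by (intro sum_nonneg) simp
      have thA: "0 \<le> th * A" using th1 A0 by simp
      show ?thesis
      proof (cases "F \<iota> \<le> A")
        case True
        have "A - F \<iota> \<le> max 0 (A - Y c \<iota>) + th" using bot[of \<iota>] by (auto simp: F_def)
        then have "(A - F \<iota>)\<^sup>2 \<le> (max 0 (A - Y c \<iota>) + th)\<^sup>2" using True by (intro power_mono) auto
        also have "\<dots> \<le> 2 * (max 0 (A - Y c \<iota>))\<^sup>2 + 2 * th\<^sup>2"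
          using zero_le_power2[of "max 0 (A - Y c \<iota>) - th"] by (simp add: power2_eq_square algebra_simps)
        also have "\<dots> \<le> 2 * (2 / l'\<^sup>2 * exp (l' * (A - Y c \<iota>))) + 2 * (th * A)"
          using square_le_exp[OF l'(1), of "A - Y c \<iota>"] False th1
          by (intro add_mono mult_left_mono) (auto simp: power2_eq_square)
        also have "\<dots> = K2 * exp (- l' * Y c \<iota>) + 2 * (th * A)"
        proof -
          have "l' * (A - Y c \<iota>) = l' * A + - l' * Y c \<iota>" by (simp add: algebra_simps)
          then show ?thesis by (simp only: l'(2) K2_def exp_add) simp
        qed
        finally show ?thesis using sum0 thA by (simp add: power2_commute)
      next
        case gt: False
        then have "F \<iota> - A \<le> s + max 0 (Y b \<iota> - A - s)" using A0 b(2) th1 unfolding F_def by auto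
        then have "(F \<iota> - A)\<^sup>2 \<le> (s + max 0 (Y b \<iota> - A - s))\<^sup>2" using gt by (intro power_mono) auto
        also have "\<dots> \<le> 2 * s\<^sup>2 + 2 * (max 0 (Y b \<iota> - A - s))\<^sup>2"
          using zero_le_power2[of "s - max 0 (Y b \<iota> - A - s)"] by (simp add: power2_eq_square algebra_simps)
        also have "\<dots> \<le> 2 * s\<^sup>2 + 2 * (2 / l\<^sup>2 * exp (l * (Y b \<iota> - A - s)))"
          by (intro add_mono mult_left_mono square_le_exp l) auto
        also have "\<dots> = 8 * (th * A) + K1 * exp (l * Y b \<iota>)"
          proof -
          have "l * (Y b \<iota> - A - s) = (- (l * A) - 2 * th) + l * Y b \<iota>"
            using l(4) by (simp add: algebra_simps)
          then show ?thesis
            using A0 th1 by (simp only: l(3,5) K1_def exp_add) (simp add: field_simps)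
        qed
        also have "K1 * exp (l * Y b \<iota>) \<le> (\<Sum>a\<in>S. K1 * exp (l * Y a \<iota>))"
          using b(1) finS K(1) by (intro member_le_sum) auto
        finally have "(F \<iota> - A)\<^sup>2 \<le> 8 * (th * A) + (\<Sum>a\<in>S. K1 * exp (l * Y a \<iota>))" by simp
        moreover have "0 \<le> K2 * exp (- l' * Y c \<iota>)" using K(2) by simp
        ultimately show ?thesis using thA by linarith
      qed
    qed
    then have "measure_pmf.expectation P (\<lambda>\<iota>. (F \<iota> - A)\<^sup>2)
        \<le> measure_pmf.expectation P (\<lambda>\<iota>. 10 * th * A + (\<Sum>a\<in>S. K1 * exp (l * Y a \<iota>)) + K2 * exp (- l' * Y c \<iota>))"
      by (intro integral_pmf_mono_set finP)
    also have "\<dots> = 10 * th * A + (\<Sum>a\<in>S. K1 * measure_pmf.expectation P (\<lambda>\<iota>. exp (l * Y a \<iota>)))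
        + K2 * measure_pmf.expectation P (\<lambda>\<iota>. exp (- l' * Y c \<iota>))"
      by (simp add: int)
    also have "\<dots> \<le> 10 * th * A + (\<Sum>a\<in>S. K1 * exp (A * (l + l\<^sup>2))) + K2 * exp (A * (- l' + l'\<^sup>2))"
      using l l' K th1 by (intro add_mono sum_mono mult_left_mono mgf mgf') auto
    also have "K2 * exp (A * (- l' + l'\<^sup>2)) = 4 * A * exp 1"
    proof -
      have "A * (- l' + l'\<^sup>2) = - (l' * A) + 1"
        using A0 by (simp add: l'(2) right_diff_distrib)
      then show ?thesis by (simp only: K2_def exp_add exp_minus) simp
    qed
    also have "\<dots> \<le> 4 * A * 3" using A0 exp_le by (intro mult_left_mono) auto
    also have "(\<Sum>a\<in>S. K1 * exp (A * (l + l\<^sup>2))) = 4 * A / th * (real (card S) * exp (- th))"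
    proof -
      have "A * (l + l\<^sup>2) = l * A + th"
        using A0 by (simp add: l(3) distrib_left)
      then have "exp (- (l * A) - 2 * th) * exp (A * (l + l\<^sup>2)) = exp (- th)"
        by (simp add: mult_exp_exp)
      then show ?thesis by (simp add: K1_def mult.assoc)
    qed
    also have "\<dots> \<le> 4 * A / th * (real M * exp (- ln (real M)))"
      using cardS A0 th1 lnM by (intro mult_left_mono mult_mono exp_mono) (auto simp: th_def)
    also have "real M * exp (- ln (real M)) = 1"
      using M0 by (simp add: exp_minus)
    also have "4 * A / th * 1 \<le> 4 * A"
      using A0 th1 by (simp add: divide_le_eq)
    finally show ?thesis by (simp add: algebra_simps)
  qed
  then show ?thesis unfolding F_def P_def p_def .
qed

subsection \<open>Chaining\<close>

lemma expectation_le_witness: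
  fixes f :: "'a \<Rightarrow> real"
  assumes fin: "finite (set_pmf P)" and le: "measure_pmf.expectation P f \<le> b"
  obtains x where "x \<in> set_pmf P" "f x \<le> b"
proof -
  have "Min (f ` set_pmf P) \<in> f ` set_pmf P"
    using fin set_pmf_not_empty by (intro Min_in) auto
  then obtain x where x: "x \<in> set_pmf P" "f x = Min (f ` set_pmf P)" by auto
  have "f x \<le> f y" if "y \<in> set_pmf P" for y
    unfolding x(2) using fin that by (intro Min_le) auto
  then have "measure_pmf.expectation P (\<lambda>_. f x) \<le> measure_pmf.expectation P f"
    by (intro integral_pmf_mono_set fin)
  then show thesis using that[OF x(1)] le by simp
qed

definition plurality_frac :: "nat \<Rightarrow> (nat \<Rightarrow> 'a \<Rightarrow> 'b) \<Rightarrow> 'a \<Rightarrow> real" where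
  "plurality_frac M \<sigma> u = real (plurality M (\<lambda>i. \<sigma> i u)) / real M"

text \<open>
  Estimate of \<open>plurality_frac M \<sigma>\<close> from \<open>2 ^ t\<close> words drawn from \<open>\<sigma>\<close>. In such a sample
  some symbol has frequency at least \<open>1 / 2 ^ t\<close> even if all frequencies in \<open>\<sigma>\<close> are \<open>1 / M\<close>; without the
  threshold the mean square error would not be proportional to \<open>plurality_frac M \<sigma>\<close>.
\<close>

definition trunc_plurality :: "nat \<Rightarrow> nat \<Rightarrow> (nat \<Rightarrow> 'a \<Rightarrow> 'b) \<Rightarrow> 'a \<Rightarrow> real" where
  "trunc_plurality M t \<tau> u = max 0 (real (plurality (2 ^ t) (\<lambda>i. \<tau> i u)) - 8 * ln (real M)) / 2 ^ t"

text \<open>This is the factor \<open>10 * th + 16\<close> of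
  \<open>sample_plurality_truncated\<close> at \<open>th = 8 * ln (real M)\<close>.\<close>

definition sampling_const :: "nat \<Rightarrow> real" where
  "sampling_const M = 80 * ln (real M) + 16"

lemma trunc_plurality_cong:
  "(\<And>i. i < 2 ^ t \<Longrightarrow> \<sigma> i = \<tau> i) \<Longrightarrow> trunc_plurality M t \<sigma> = trunc_plurality M t \<tau>"
  unfolding trunc_plurality_def using plurality_cong[of "2 ^ t" "\<lambda>i. \<sigma> i _" "\<lambda>i. \<tau> i _"] by auto

text \<open>One word has plurality 1, which lies below the threshold. Hence the chain starts at zero
  and its telescoping sum has no initial term.\<close>

lemma trunc_plurality_0:
  assumes "2 \<le> M"
  shows "trunc_plurality M 0 \<tau> u = 0"
proof -
  have "2 / 3 \<le> ln (2::real)" by (rule ln2_ge_two_thirds)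
  also have "\<dots> \<le> ln (real M)" using assms by simp
  finally show ?thesis
    using plurality_le[of 1 "\<lambda>i. \<tau> i u"] by (simp add: trunc_plurality_def max_def)
qed

lemma sampling_const_nonneg: "2 \<le> M \<Longrightarrow> 0 \<le> sampling_const M"
  unfolding sampling_const_def by (intro add_nonneg_nonneg mult_nonneg_nonneg ln_ge_zero) auto

text \<open>Probabilistic method: the weighted error has small mean over random index tuples, so
  some tuple attains it. The points \<open>v x\<close> and weights \<open>w x\<close> are arbitrary,
  which lets one sublist serve all columns of interest together.\<close>

lemma sampled_sublist_exists:
  fixes \<sigma> :: "nat \<Rightarrow> 'a \<Rightarrow> 'b" and w :: "'x \<Rightarrow> real"
  assumes M: "2 \<le> M" and V: "finite V" and w: "\<And>x. x \<in> V \<Longrightarrow> 0 \<le> w x"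
  obtains \<iota> :: "nat \<Rightarrow> nat" where "\<And>i. i < 2 ^ t \<Longrightarrow> \<iota> i < M"
    "(\<Sum>x\<in>V. w x * (trunc_plurality M t (\<lambda>i. \<sigma> (\<iota> i)) (v x) - plurality_frac M \<sigma> (v x))\<^sup>2)
      \<le> sampling_const M / 2 ^ t * (\<Sum>x\<in>V. w x * plurality_frac M \<sigma> (v x))"
proof -
  define P where "P = Pi_pmf {..<2 ^ t :: nat} (0::nat) (\<lambda>_. pmf_of_set {..<M})"
  have M0: "{..<M} \<noteq> {}" using M by (auto simp: lessThan_empty_iff)
  have sP: "set_pmf P = PiE_dflt {..<2 ^ t :: nat} 0 (\<lambda>_. {..<M})"
    unfolding P_def using M0 by (simp add: set_Pi_pmf o_def)
  have finP: "finite (set_pmf P)" unfolding sP by (intro finite_PiE_dflt) auto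
  note int = integrable_measure_pmf_finite[OF finP]
  have four: "(4::real) ^ t = 2 ^ t * 2 ^ t" by (simp add: power_mult_distrib[symmetric])
  have one: "measure_pmf.expectation P (\<lambda>\<iota>. (trunc_plurality M t (\<lambda>i. \<sigma> (\<iota> i)) u - plurality_frac M \<sigma> u)\<^sup>2)
      \<le> sampling_const M / 2 ^ t * plurality_frac M \<sigma> u" for u
  proof -
    let ?F = "\<lambda>\<iota>. (max 0 (real (plurality (2 ^ t) (\<lambda>i. \<sigma> (\<iota> i) u)) - 8 * ln (real M))
        - 2 ^ t * real (plurality M (\<lambda>i. \<sigma> i u)) / real M)\<^sup>2"
    have "(trunc_plurality M t (\<lambda>i. \<sigma> (\<iota> i)) u - plurality_frac M \<sigma> u)\<^sup>2 = ?F \<iota> / 4 ^ t" for \<iota>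
      unfolding trunc_plurality_def plurality_frac_def
      by (simp add: power_mult_distrib[symmetric] power_divide[symmetric] field_simps
          power2_eq_square[of "2 ^ t"] flip: power_mult_distrib)
    then have "measure_pmf.expectation P (\<lambda>\<iota>. (trunc_plurality M t (\<lambda>i. \<sigma> (\<iota> i)) u - plurality_frac M \<sigma> u)\<^sup>2)
        = measure_pmf.expectation P ?F / 4 ^ t"
      by simp
    also have "\<dots> \<le> sampling_const M * (2 ^ t * real (plurality M (\<lambda>i. \<sigma> i u)) / real M) / 4 ^ t"
      using sample_plurality_truncated[OF M, of "2 ^ t" 0 "\<lambda>i. \<sigma> i u"]
      unfolding P_def sampling_const_def by (intro divide_right_mono) simp_all
    also have "\<dots> = sampling_const M / 2 ^ t * plurality_frac M \<sigma> u"
      unfolding plurality_frac_def four by (simp add: field_simps)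
    finally show ?thesis .
  qed
  have "measure_pmf.expectation P (\<lambda>\<iota>.
      \<Sum>x\<in>V. w x * (trunc_plurality M t (\<lambda>i. \<sigma> (\<iota> i)) (v x) - plurality_frac M \<sigma> (v x))\<^sup>2)
    = (\<Sum>x\<in>V. w x * measure_pmf.expectation P (\<lambda>\<iota>.
        (trunc_plurality M t (\<lambda>i. \<sigma> (\<iota> i)) (v x) - plurality_frac M \<sigma> (v x))\<^sup>2))"
    by (simp add: int)
  also have "\<dots> \<le> (\<Sum>x\<in>V. w x * (sampling_const M / 2 ^ t * plurality_frac M \<sigma> (v x)))"
    by (intro sum_mono mult_left_mono one w)
  also have "\<dots> = sampling_const M / 2 ^ t * (\<Sum>x\<in>V. w x * plurality_frac M \<sigma> (v x))"
    by (simp add: sum_distrib_left mult_ac)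
  finally obtain \<iota> where "\<iota> \<in> set_pmf P"
    "(\<Sum>x\<in>V. w x * (trunc_plurality M t (\<lambda>i. \<sigma> (\<iota> i)) (v x) - plurality_frac M \<sigma> (v x))\<^sup>2)
      \<le> sampling_const M / 2 ^ t * (\<Sum>x\<in>V. w x * plurality_frac M \<sigma> (v x))"
    using expectation_le_witness[OF finP] by blast
  then show thesis using that[of \<iota>] unfolding sP PiE_dflt_def by auto
qed

text \<open>Levels \<open>0, \<dots>, T\<close> of the chain use samples; level \<open>T + 1\<close> is the list itself.\<close>

definition level_size :: "nat \<Rightarrow> nat \<Rightarrow> nat \<Rightarrow> nat" where
  "level_size M T t = (if t \<le> T then 2 ^ t else M)"

definition level_approx :: "nat \<Rightarrow> nat \<Rightarrow> nat \<Rightarrow> (nat \<Rightarrow> 'a \<Rightarrow> 'b) \<Rightarrow> 'a \<Rightarrow> real" where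
  "level_approx M T t = (if t \<le> T then trunc_plurality M t else plurality_frac M)"

lemma level_approx_exists:
  fixes \<sigma> :: "nat \<Rightarrow> 'a \<Rightarrow> 'b" and w :: "'x \<Rightarrow> real"
  assumes M: "2 \<le> M" and V: "finite V" and w: "\<And>x. x \<in> V \<Longrightarrow> 0 \<le> w x"
    and \<sigma>: "\<sigma> \<in> {..<M} \<rightarrow>\<^sub>E C"
  obtains \<tau> where "\<tau> \<in> {..<level_size M T t} \<rightarrow>\<^sub>E C" "T < t \<Longrightarrow> \<tau> = \<sigma>"
    "(\<Sum>x\<in>V. w x * (level_approx M T t \<tau> (v x) - plurality_frac M \<sigma> (v x))\<^sup>2)
      \<le> sampling_const M / 2 ^ t * (\<Sum>x\<in>V. w x * plurality_frac M \<sigma> (v x))"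
proof (cases "t \<le> T")
  case True
  obtain \<iota> :: "nat \<Rightarrow> nat" where \<iota>: "\<And>i. i < 2 ^ t \<Longrightarrow> \<iota> i < M"
    "(\<Sum>x\<in>V. w x * (trunc_plurality M t (\<lambda>i. \<sigma> (\<iota> i)) (v x) - plurality_frac M \<sigma> (v x))\<^sup>2)
      \<le> sampling_const M / 2 ^ t * (\<Sum>x\<in>V. w x * plurality_frac M \<sigma> (v x))"
    using sampled_sublist_exists[where w = w and t = t and \<sigma> = \<sigma> and v = v, OF M V w] by blast
  \<comment> \<open>Restriction makes the sublist extensional, hence a member of the finite set of
    tuples over which the union bound runs.\<close>
  define \<tau> where "\<tau> = restrict (\<lambda>i. \<sigma> (\<iota> i)) {..<2 ^ t}"
  have "trunc_plurality M t \<tau> = trunc_plurality M t (\<lambda>i. \<sigma> (\<iota> i))"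
    by (intro trunc_plurality_cong) (simp add: \<tau>_def)
  moreover have "\<tau> \<in> {..<2 ^ t} \<rightarrow>\<^sub>E C" using \<sigma> \<iota>(1) unfolding \<tau>_def by auto
  ultimately show thesis using that[of \<tau>] \<iota>(2) True
    by (simp add: level_size_def level_approx_def)
next
  case False
  have "0 \<le> plurality_frac M \<sigma> u" for u unfolding plurality_frac_def by simp
  then have "0 \<le> (\<Sum>x\<in>V. w x * plurality_frac M \<sigma> (v x))"
    using w by (intro sum_nonneg) simp
  then show thesis using that[of \<sigma>] \<sigma> False sampling_const_nonneg[OF M]
    by (simp add: level_size_def level_approx_def)
qed

text \<open>The bound is implicit, since the sampled plurality also occurs on the right;
  \<open>deviation_contradiction\<close> resolves this for small \<open>l\<close>. The condition
  \<open>M \<le> 2 ^ Suc T\<close> keeps the last link, from \<open>2 ^ T\<close> words to the whole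
  list, as cheap as the others.\<close>

theorem uniform_plurality_deviation:
  fixes p :: "'a pmf" and C :: "('a \<Rightarrow> 'b) set"
  assumes p: "finite (set_pmf p)" and C: "finite C" "2 \<le> card C"
    and M: "2 \<le> M" "M \<le> 2 ^ Suc T" and l: "0 < l"
  shows "1 / 2 \<le> measure_pmf.prob (Pi_pmf {..<n} d (\<lambda>_. p))
    {J. \<forall>\<sigma>\<in>{..<M} \<rightarrow>\<^sub>E C.
      (\<Sum>j<n. plurality_frac M \<sigma> (J j)) - real n * measure_pmf.expectation p (plurality_frac M \<sigma>)
      \<le> real (Suc T) * (5 * ln (real (card C)) / l + 3 * sampling_const M * l *
          ((\<Sum>j<n. plurality_frac M \<sigma> (J j)) + real n * measure_pmf.expectation p (plurality_frac M \<sigma>)))}"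
proof -
  define N where "N = real (card C)"
  have N2: "2 \<le> N" using C by (simp add: N_def)
  define Tup where "Tup m = {..<m} \<rightarrow>\<^sub>E C" for m :: nat
  \<comment> \<open>Links join arbitrary tuples of adjacent levels, whether or not they come from a
    common list. The events are thus fixed before \<open>J\<close>, and sublists chosen in view of
    \<open>J\<close> are still covered.\<close>
  define I where "I = (SIGMA t:{..T}. Tup (level_size M T t) \<times> Tup (level_size M T (Suc t)))"
  define D where "D t \<tau> \<tau>' u = level_approx M T (Suc t) \<tau>' u - level_approx M T t \<tau> u"
    for t and \<tau> \<tau>' :: "nat \<Rightarrow> 'a \<Rightarrow> 'b" and u
  \<comment> \<open>The scale \<open>2 ^ t\<close> matches the squared error of order
    \<open>sampling_const M / 2 ^ t\<close>: after division by \<open>l * 2 ^ t\<close>, both the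
    slack and the quadratic term are the same at every level.\<close>
  define Y where "Y = (\<lambda>(t, \<tau>, \<tau>') u. l * 2 ^ t * D t \<tau> \<tau>' u)"
  \<comment> \<open>Of the exponent \<open>5 * 2 ^ t\<close> of \<open>N\<close>, three parts pay
    for the number of links. The remaining \<open>N\<close> to the power \<open>- 2 * 2 ^ t\<close>
    is at most \<open>(1 / 2) ^ (t + 2)\<close>, and these sum to less than
    \<open>1 / 2\<close>.\<close>
  define s where "s = (\<lambda>(t, _ :: (nat \<Rightarrow> 'a \<Rightarrow> 'b) \<times> (nat \<Rightarrow> 'a \<Rightarrow> 'b)). 5 * 2 ^ t * ln N)"
  have finTup: "finite (Tup m)" for m unfolding Tup_def using C by (intro finite_PiE) auto
  have cardTup: "card (Tup m) = card C ^ m" for m unfolding Tup_def using C by (simp add: card_PiE)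
  have finI: "finite I" unfolding I_def by (intro finite_SigmaI finite_cartesian_product finTup) auto
  have sizes: "level_size M T t + level_size M T (Suc t) \<le> 3 * 2 ^ t" if "t \<le> T" for t
    using that M(2) by (cases "t = T") (auto simp: level_size_def)
  have "(\<Sum>i\<in>I. exp (- s i)) = (\<Sum>t\<le>T. N ^ (level_size M T t + level_size M T (Suc t)) * exp (- (5 * 2 ^ t * ln N)))"
  proof -
    have "(\<Sum>i\<in>I. exp (- s i)) = (\<Sum>(t, x)\<in>I. exp (- (5 * 2 ^ t * ln N)))"
      by (intro sum.cong) (auto simp: s_def)
    also have "\<dots> = (\<Sum>t\<le>T. \<Sum>x\<in>Tup (level_size M T t) \<times> Tup (level_size M T (Suc t)).
        exp (- (5 * 2 ^ t * ln N)))"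
      unfolding I_def by (intro sum.Sigma[symmetric]) (auto simp: finTup)
    finally show ?thesis
      by (simp add: cardTup card_cartesian_product power_add N_def)
  qed
  also have "\<dots> \<le> (\<Sum>t\<le>T. (1 / 2) ^ (t + 2))"
  proof (intro sum_mono)
    fix t assume "t \<in> {..T}"
    then have t: "t \<le> T" by simp
    have e: "exp (5 * 2 ^ t * ln N) = N ^ (5 * 2 ^ t)"
      using N2 exp_of_nat_mult[of "5 * 2 ^ t" "ln N"] by simp
    have "N ^ (level_size M T t + level_size M T (Suc t)) \<le> N ^ (3 * 2 ^ t)"
      using N2 sizes[OF t] by (intro power_increasing) auto
    then have "N ^ (level_size M T t + level_size M T (Suc t)) * exp (- (5 * 2 ^ t * ln N))
        \<le> N ^ (3 * 2 ^ t) * exp (- (5 * 2 ^ t * ln N))" by simp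
    also have "\<dots> = 1 / N ^ (2 * 2 ^ t)"
    proof -
      have "N ^ (5 * 2 ^ t) = N ^ (3 * 2 ^ t) * N ^ (2 * 2 ^ t)"
        by (simp add: power_add[symmetric])
      then show ?thesis using N2 unfolding exp_minus e by (simp add: divide_inverse)
    qed
    also have "\<dots> \<le> 1 / 2 ^ (t + 2)"
    proof (intro divide_left_mono)
      have "t + 2 \<le> 2 * 2 ^ t" using less_exp[of t] by (simp add: Suc_le_eq[symmetric])
      then have "(2::real) ^ (t + 2) \<le> 2 ^ (2 * 2 ^ t)" by (intro power_increasing) auto
      also have "\<dots> \<le> N ^ (2 * 2 ^ t)" using N2 by (intro power_mono) auto
      finally show "2 ^ (t + 2) \<le> N ^ (2 * 2 ^ t)" .
    qed (use N2 in auto)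
    finally show "N ^ (level_size M T t + level_size M T (Suc t)) * exp (- (5 * 2 ^ t * ln N)) \<le> (1 / 2) ^ (t + 2)"
      by (simp add: power_one_over)
  qed
  also have "\<dots> = 1 / 2 - (1 / 2) ^ (T + 2)"
    by (induction T) (simp_all add: power2_eq_square)
  also have "\<dots> \<le> 1 / 2" by simp
  finally have "1 - 1 / 2 \<le> measure_pmf.prob (Pi_pmf {..<n} d (\<lambda>_. p))
      {J. \<forall>i\<in>I. (\<Sum>j\<in>{..<n}. Y i (J j) - (Y i (J j))\<^sup>2)
        < real (card {..<n}) * (measure_pmf.expectation p (Y i)
            + measure_pmf.expectation p (\<lambda>u. (Y i u)\<^sup>2)) + s i}"
    by (intro prob_self_normalized_family p finI) auto
  also have "\<dots> \<le> measure_pmf.prob (Pi_pmf {..<n} d (\<lambda>_. p))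
    {J. \<forall>\<sigma>\<in>{..<M} \<rightarrow>\<^sub>E C.
      (\<Sum>j<n. plurality_frac M \<sigma> (J j)) - real n * measure_pmf.expectation p (plurality_frac M \<sigma>)
      \<le> real (Suc T) * (5 * ln N / l + 3 * sampling_const M * l *
          ((\<Sum>j<n. plurality_frac M \<sigma> (J j)) + real n * measure_pmf.expectation p (plurality_frac M \<sigma>)))}"
  proof (intro measure_pmf.finite_measure_mono subsetI CollectI ballI)
    fix J \<sigma>
    assume "J \<in> {J. \<forall>i\<in>I. (\<Sum>j\<in>{..<n}. Y i (J j) - (Y i (J j))\<^sup>2)
        < real (card {..<n}) * (measure_pmf.expectation p (Y i)
            + measure_pmf.expectation p (\<lambda>u. (Y i u)\<^sup>2)) + s i}"
    then have good: "(\<Sum>j<n. Y i (J j) - (Y i (J j))\<^sup>2)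
        < real n * (measure_pmf.expectation p (Y i) + measure_pmf.expectation p (\<lambda>u. (Y i u)\<^sup>2)) + s i"
      if "i \<in> I" for i using that by simp
    assume \<sigma>: "\<sigma> \<in> {..<M} \<rightarrow>\<^sub>E C"
    define a where "a = plurality_frac M \<sigma>"
    define E where "E f = measure_pmf.expectation p f" for f :: "'a \<Rightarrow> real"
    define B where "B f = (\<Sum>j<n. f (J j)) - real n * E f" for f
    \<comment> \<open>\<open>W\<close> sums over the sampled columns and adds \<open>n\<close> times the mean. A sublist must
      approximate well in this combined weight, so it is chosen after \<open>J\<close>.\<close>
    define V where "V = {..<n} <+> set_pmf p"
    define v where "v = case_sum J (\<lambda>u. u)"
    define w where "w = case_sum (\<lambda>_ :: nat. 1) (\<lambda>u. real n * pmf p u)"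
    define W where "W f = (\<Sum>x\<in>V. w x * f (v x))" for f
    have finV: "finite V" unfolding V_def using p by auto
    have w0: "0 \<le> w x" for x unfolding w_def by (cases x) auto
    have Esum: "E f = (\<Sum>u\<in>set_pmf p. pmf p u * f u)" for f
      unfolding E_def using p by (subst integral_measure_pmf[OF p]) auto
    have W: "W f = (\<Sum>j<n. f (J j)) + real n * E f" for f
      unfolding W_def V_def Esum using p
      by (simp add: sum.Plus w_def v_def sum_distrib_left mult.assoc)
    have a0: "0 \<le> W a" unfolding W_def a_def plurality_frac_def using w0 by (intro sum_nonneg) simp
    have K0: "0 \<le> sampling_const M" using sampling_const_nonneg[OF M(1)] .
    have "\<exists>\<tau>. \<tau> \<in> Tup (level_size M T t) \<and> (T < t \<longrightarrow> \<tau> = \<sigma>) \<and>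
        W (\<lambda>u. (level_approx M T t \<tau> u - a u)\<^sup>2) \<le> sampling_const M / 2 ^ t * W a" for t
      unfolding W_def Tup_def a_def
      by (rule level_approx_exists[where w = w and T = T and t = t and v = v, OF M(1) finV w0 \<sigma>]) blast
    then obtain \<tau> where \<tau>: "\<tau> t \<in> Tup (level_size M T t)" "T < t \<Longrightarrow> \<tau> t = \<sigma>"
        "W (\<lambda>u. (level_approx M T t (\<tau> t) u - a u)\<^sup>2) \<le> sampling_const M / 2 ^ t * W a" for t
      by metis
    define A where "A t = level_approx M T t (\<tau> t)" for t
    have step: "B (\<lambda>u. A (Suc t) u - A t u) \<le> 5 * ln N / l + 3 * sampling_const M * l * W a"
      if t: "t \<le> T" for t
    proof -
      define f where "f u = A (Suc t) u - A t u" for u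
      define c where "c = l * 2 ^ t"
      have c0: "0 < c" using l by (simp add: c_def)
      have "(t, \<tau> t, \<tau> (Suc t)) \<in> I" unfolding I_def using t \<tau>(1) by simp
      from good[OF this] have "(\<Sum>j<n. c * f (J j) - (c * f (J j))\<^sup>2)
          < real n * (E (\<lambda>u. c * f u) + E (\<lambda>u. (c * f u)\<^sup>2)) + 5 * 2 ^ t * ln N"
        unfolding Y_def D_def s_def E_def f_def A_def c_def by simp
      \<comment> \<open>The sampled squares, moved to the right, and \<open>n\<close> times the mean
        square together form \<open>W\<close> of the square. This is the reason for the combined
        weight.\<close>
      then have "c * B f \<le> c\<^sup>2 * W (\<lambda>u. (f u)\<^sup>2) + 5 * 2 ^ t * ln N"
        unfolding W B_def
        by (simp add: E_def power_mult_distrib sum_subtractf sum_distrib_left[symmetric] algebra_simps)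
      \<comment> \<open>Passing through \<open>a\<close> reduces a link to the errors of its two
        ends; these add up to the factor 3 in the statement.\<close>
      also have "W (\<lambda>u. (f u)\<^sup>2) \<le> W (\<lambda>u. 2 * (A (Suc t) u - a u)\<^sup>2 + 2 * (A t u - a u)\<^sup>2)"
        unfolding W_def
      proof (intro sum_mono mult_left_mono w0)
        fix x
        show "(f (v x))\<^sup>2 \<le> 2 * (A (Suc t) (v x) - a (v x))\<^sup>2 + 2 * (A t (v x) - a (v x))\<^sup>2"
          using zero_le_power2[of "(A (Suc t) (v x) - a (v x)) + (A t (v x) - a (v x))"]
          unfolding f_def by (simp add: power2_eq_square algebra_simps)
      qed
      also have "\<dots> = 2 * W (\<lambda>u. (A (Suc t) u - a u)\<^sup>2) + 2 * W (\<lambda>u. (A t u - a u)\<^sup>2)"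
        unfolding W_def by (simp add: distrib_left sum.distrib sum_distrib_left mult_ac)
      also have "\<dots> \<le> 2 * (sampling_const M / 2 ^ Suc t * W a) + 2 * (sampling_const M / 2 ^ t * W a)"
        unfolding A_def by (intro add_mono mult_left_mono \<tau>(3)) auto
      also have "\<dots> = 3 * sampling_const M * W a / 2 ^ t"
        by (simp add: field_simps)
      finally have "c * B f \<le> c\<^sup>2 * (3 * sampling_const M * W a / 2 ^ t) + 5 * 2 ^ t * ln N"
        by (simp add: mult_left_mono)
      also have "\<dots> = c * (5 * ln N / l + 3 * sampling_const M * l * W a)"
        using l by (simp add: c_def power2_eq_square field_simps)
      finally show ?thesis using c0 unfolding f_def by simp
    qed
    \<comment> \<open>The chain telescopes from zero at level 0 to \<open>a\<close> itself at level
      \<open>Suc T\<close>.\<close>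
    have "B a = B (\<lambda>u. \<Sum>t\<le>T. A (Suc t) u - A t u)"
    proof -
      have "(\<Sum>t\<le>T. A (Suc t) u - A t u) = a u" for u
      proof -
        have "(\<Sum>t\<le>T. A (Suc t) u - A t u) = A (Suc T) u - A 0 u"
          using sum_lessThan_telescope[of "\<lambda>t. A t u" "Suc T"] by (simp only: lessThan_Suc_atMost)
        then show ?thesis using \<tau>(2)[of "Suc T"] trunc_plurality_0[OF M(1)]
          by (simp add: A_def level_approx_def a_def)
      qed
      then show ?thesis by simp
    qed
    also have "\<dots> = (\<Sum>t\<le>T. B (\<lambda>u. A (Suc t) u - A t u))"
    proof -
      have "(\<Sum>j<n. \<Sum>t\<le>T. A (Suc t) (J j) - A t (J j)) = (\<Sum>t\<le>T. \<Sum>j<n. A (Suc t) (J j) - A t (J j))"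
        by (rule sum.swap)
      moreover have "E (\<lambda>u. \<Sum>t\<le>T. A (Suc t) u - A t u) = (\<Sum>t\<le>T. E (\<lambda>u. A (Suc t) u - A t u))"
        unfolding E_def by (intro Bochner_Integration.integral_sum integrable_measure_pmf_finite p)
      ultimately show ?thesis unfolding B_def by (simp add: sum_subtractf sum_distrib_left)
    qed
    also have "\<dots> \<le> (\<Sum>t\<le>T. 5 * ln N / l + 3 * sampling_const M * l * W a)"
      by (intro sum_mono step) simp
    finally show "(\<Sum>j<n. plurality_frac M \<sigma> (J j)) - real n * measure_pmf.expectation p (plurality_frac M \<sigma>)
      \<le> real (Suc T) * (5 * ln N / l + 3 * sampling_const M * l *
          ((\<Sum>j<n. plurality_frac M \<sigma> (J j)) + real n * measure_pmf.expectation p (plurality_frac M \<sigma>)))"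
      unfolding W unfolding B_def E_def a_def by simp
  qed simp
  finally show ?thesis unfolding N_def by simp
qed

subsection \<open>Mean plurality\<close>

lemma sum_card_fibres:
  assumes "finite A" "finite B" "f ` A \<subseteq> B"
  shows "(\<Sum>b\<in>B. card {a \<in> A. f a = b}) = card A"
proof -
  have "(\<Sum>b\<in>B. card {a \<in> A. f a = b}) = card (\<Union>b\<in>B. {a \<in> A. f a = b})"
    using assms by (intro card_UN_disjoint[symmetric]) auto
  also have "(\<Union>b\<in>B. {a \<in> A. f a = b}) = A" using assms by auto
  finally show ?thesis .
qed

text \<open>The plurality is one of the symbol counts, so its squared deviation from
  \<open>M / card S\<close> is one term of the sum over all symbols. The sum of the squared counts
  is the number of agreeing ordered pairs, the diagonal included.\<close>

lemma plurality_second_moment: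
  assumes M: "0 < M" and S: "finite S" "S \<noteq> {}" "\<And>i. i < M \<Longrightarrow> g i \<in> S"
  shows "(real (plurality M g) - real M / real (card S))\<^sup>2
    \<le> (\<Sum>i<M. \<Sum>j<M. of_bool (g i = g j)) - (real M)\<^sup>2 / real (card S)"
proof -
  define b where "b a = real (card {i \<in> {..<M}. g i = a})" for a
  define q where "q = real (card S)"
  have q: "0 < q" using S by (simp add: q_def card_gt_0_iff)
  obtain i where i: "i < M" "plurality M g = card {k \<in> {..<M}. g k = g i}"
    using plurality_attained[OF M] .
  have sumb: "(\<Sum>a\<in>S. b a) = real M"
  proof -
    have "g ` {..<M} \<subseteq> S" using S by auto
    then have "(\<Sum>a\<in>S. card {i \<in> {..<M}. g i = a}) = M"
      using sum_card_fibres[of "{..<M}" S g] S by simp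
    then show ?thesis unfolding b_def of_nat_sum[symmetric] by simp
  qed
  have "(\<Sum>a\<in>S. (b a)\<^sup>2) = (\<Sum>a\<in>S. \<Sum>i<M. \<Sum>j<M. of_bool (g i = a) * of_bool (g j = a))"
  proof (intro sum.cong refl)
    fix a
    have "b a = (\<Sum>i<M. of_bool (g i = a))"
      unfolding b_def by (simp add: sum.If_cases of_bool_def Int_def)
    then show "(b a)\<^sup>2 = (\<Sum>i<M. \<Sum>j<M. of_bool (g i = a) * of_bool (g j = a))"
      by (simp only: power2_eq_square sum_product)
  qed
  also have "\<dots> = (\<Sum>i<M. \<Sum>j<M. \<Sum>a\<in>S. of_bool (g i = a) * of_bool (g j = a))"
    by (subst sum.swap, intro sum.cong refl, subst sum.swap) simp
  also have "\<dots> = (\<Sum>i<M. \<Sum>j<M. of_bool (g i = g j))"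
  proof (intro sum.cong refl)
    fix i j assume "i \<in> {..<M}" "j \<in> {..<M}"
    have "(\<Sum>a\<in>S. of_bool (g i = a) * of_bool (g j = a)) = (\<Sum>a\<in>S. if a = g i then of_bool (g i = g j) else (0::real))"
      by (intro sum.cong) auto
    also have "\<dots> = of_bool (g i = g j)" using S \<open>i \<in> {..<M}\<close> by simp
    finally show "(\<Sum>a\<in>S. of_bool (g i = a) * of_bool (g j = a)) = (of_bool (g i = g j) :: real)" .
  qed
  finally have sumb2: "(\<Sum>a\<in>S. (b a)\<^sup>2) = (\<Sum>i<M. \<Sum>j<M. of_bool (g i = g j))" .
  have "(real (plurality M g) - real M / q)\<^sup>2 = (b (g i) - real M / q)\<^sup>2"
    by (simp add: b_def i)
  also have "\<dots> \<le> (\<Sum>a\<in>S. (b a - real M / q)\<^sup>2)"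
    using S i by (intro member_le_sum) auto
  also have "\<dots> = (\<Sum>a\<in>S. (b a)\<^sup>2) - 2 * (real M / q) * (\<Sum>a\<in>S. b a) + q * (real M / q)\<^sup>2"
  proof -
    have "(\<Sum>a\<in>S. (b a - c)\<^sup>2) = (\<Sum>a\<in>S. (b a)\<^sup>2) - 2 * c * (\<Sum>a\<in>S. b a) + q * c\<^sup>2" for c
      by (simp add: power2_diff sum.distrib sum_subtractf sum_distrib_left sum_distrib_right mult_ac q_def)
    then show ?thesis .
  qed
  also have "\<dots> = (\<Sum>a\<in>S. (b a)\<^sup>2) - (real M)\<^sup>2 / q"
    using q unfolding sumb by (simp add: field_simps power2_eq_square)
  finally show ?thesis unfolding sumb2 q_def .
qed

text \<open>Diagonal pairs contribute \<open>1 / M\<close> to the variance and the other pairs at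
  most \<open>\<delta>\<close>. With \<open>\<delta> = \<epsilon>^2 / 2\<close> this requires
  \<open>M\<close> to be at least \<open>2 / \<epsilon>^2\<close>, which is where the list size
  comes from.\<close>

lemma expectation_plurality_frac_le:
  fixes \<sigma> :: "nat \<Rightarrow> 'a \<Rightarrow> 'b"
  assumes p: "finite (set_pmf p)" and M: "0 < M" and S: "finite S" "S \<noteq> {}"
    and \<sigma>: "\<And>i u. i < M \<Longrightarrow> u \<in> set_pmf p \<Longrightarrow> \<sigma> i u \<in> S"
    and agr: "\<And>i j. i < M \<Longrightarrow> j < M \<Longrightarrow> i \<noteq> j \<Longrightarrow>
      measure_pmf.prob p {u. \<sigma> i u = \<sigma> j u} \<le> 1 / real (card S) + \<delta>"
    and \<delta>: "0 \<le> \<delta>" "1 / real M + \<delta> \<le> \<epsilon>\<^sup>2" and \<epsilon>: "0 < \<epsilon>"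
  shows "measure_pmf.expectation p (plurality_frac M \<sigma>) \<le> 1 / real (card S) + \<epsilon>"
proof -
  note int = integrable_measure_pmf_finite[OF p]
  define q where "q = real (card S)"
  have q: "0 < q" using S by (simp add: q_def card_gt_0_iff)
  have m: "0 < real M" using M by simp
  have pair: "measure_pmf.expectation p (\<lambda>u. of_bool (\<sigma> i u = \<sigma> j u)) \<le> of_bool (i = j) + (1 / q + \<delta>)"
    if "i < M" "j < M" for i j
  proof -
    have "measure_pmf.expectation p (\<lambda>u. of_bool (\<sigma> i u = \<sigma> j u))
        = measure_pmf.expectation p (indicator {u. \<sigma> i u = \<sigma> j u})"
      by (intro Bochner_Integration.integral_cong) (auto simp: indicator_def)
    also have "\<dots> = measure_pmf.prob p {u. \<sigma> i u = \<sigma> j u}" by simp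
    also have "\<dots> \<le> of_bool (i = j) + (1 / q + \<delta>)"
    proof (cases "i = j")
      case True
      have "measure_pmf.prob p {u. \<sigma> i u = \<sigma> j u} \<le> 1" by simp
      moreover have "0 \<le> 1 / q + \<delta>" using q \<delta> by simp
      ultimately show ?thesis using True by simp
    qed (use agr that in \<open>simp add: q_def\<close>)
    finally show ?thesis .
  qed
  have "measure_pmf.expectation p (\<lambda>u. (real (plurality M (\<lambda>i. \<sigma> i u)) - real M / q)\<^sup>2)
      \<le> measure_pmf.expectation p (\<lambda>u. (\<Sum>i<M. \<Sum>j<M. of_bool (\<sigma> i u = \<sigma> j u)) - (real M)\<^sup>2 / q)"
    unfolding q_def by (intro integral_pmf_mono_set p plurality_second_moment M S \<sigma>)
  also have "\<dots> = (\<Sum>i<M. \<Sum>j<M. measure_pmf.expectation p (\<lambda>u. of_bool (\<sigma> i u = \<sigma> j u))) - (real M)\<^sup>2 / q"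
    by (simp add: int del: sum_of_bool_eq)
  also have "\<dots> \<le> (\<Sum>i<M. \<Sum>j<M. of_bool (i = j) + (1 / q + \<delta>)) - (real M)\<^sup>2 / q"
    by (intro diff_right_mono sum_mono pair) auto
  also have "\<dots> = real M + (real M)\<^sup>2 * \<delta>"
    by (simp add: sum.distrib power2_eq_square algebra_simps of_bool_def)
  finally have V: "measure_pmf.expectation p (\<lambda>u. (real (plurality M (\<lambda>i. \<sigma> i u)) - real M / q)\<^sup>2)
      \<le> real M + (real M)\<^sup>2 * \<delta>" .
  have sq: "(plurality_frac M \<sigma> u - 1 / q)\<^sup>2 = (real (plurality M (\<lambda>i. \<sigma> i u)) - real M / q)\<^sup>2 / (real M)\<^sup>2" for u
    unfolding plurality_frac_def power_divide[symmetric] using m q by (simp add: diff_divide_distrib)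
  have "measure_pmf.expectation p (\<lambda>u. (plurality_frac M \<sigma> u - 1 / q)\<^sup>2)
      \<le> (real M + (real M)\<^sup>2 * \<delta>) / (real M)\<^sup>2"
    unfolding sq using V by (simp add: divide_right_mono)
  also have "\<dots> = 1 / real M + \<delta>" using m by (simp add: field_simps power2_eq_square)
  finally have V': "measure_pmf.expectation p (\<lambda>u. (plurality_frac M \<sigma> u - 1 / q)\<^sup>2) \<le> \<epsilon>\<^sup>2"
    using \<delta> by simp
  \<comment> \<open>The inequality \<open>x \<le> \<epsilon> / 2 + x^2 / (2 * \<epsilon>)\<close>
    passes from the second moment to the first; it is sharp at
    \<open>x = \<epsilon>\<close>.\<close>
  have "plurality_frac M \<sigma> u \<le> 1 / q + \<epsilon> / 2 + (plurality_frac M \<sigma> u - 1 / q)\<^sup>2 / (2 * \<epsilon>)" for u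
  proof -
    have "0 \<le> (plurality_frac M \<sigma> u - 1 / q - \<epsilon>)\<^sup>2 / (2 * \<epsilon>)" using \<epsilon> by simp
    also have "\<dots> = (plurality_frac M \<sigma> u - 1 / q)\<^sup>2 / (2 * \<epsilon>) - (plurality_frac M \<sigma> u - 1 / q) + \<epsilon> / 2"
      unfolding power2_diff[of _ \<epsilon>] using \<epsilon> by (simp add: field_simps power2_eq_square)
    finally show ?thesis by simp
  qed
  then have "measure_pmf.expectation p (plurality_frac M \<sigma>)
      \<le> measure_pmf.expectation p (\<lambda>u. 1 / q + \<epsilon> / 2 + (plurality_frac M \<sigma> u - 1 / q)\<^sup>2 / (2 * \<epsilon>))"
    by (intro integral_pmf_mono_set p)
  also have "\<dots> = 1 / q + \<epsilon> / 2 + measure_pmf.expectation p (\<lambda>u. (plurality_frac M \<sigma> u - 1 / q)\<^sup>2) / (2 * \<epsilon>)"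
    by (simp add: int)
  also have "\<dots> \<le> 1 / q + \<epsilon> / 2 + \<epsilon>\<^sup>2 / (2 * \<epsilon>)"
    using V' \<epsilon> by (intro add_left_mono divide_right_mono) auto
  also have "\<dots> = 1 / q + \<epsilon>" using \<epsilon> by (simp add: power2_eq_square)
  finally show ?thesis unfolding q_def .
qed

section \<open>Arithmetic of the constants\<close>

text \<open>Without the \<open>\<mu>\<close> terms the assumptions leave a gap of at least
  \<open>1.4 * \<epsilon>\<close> per column. These terms cost at most
  \<open>2 * \<mu> / q + 4.4 * \<mu> * \<epsilon>\<close>, that is \<open>0.64 * \<epsilon>\<close>.
  The bound \<open>\<mu> \<le> q * \<epsilon> / 10\<close> matters when \<open>1 / q\<close> is much
  larger than \<open>\<epsilon>\<close>.\<close>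

lemma deviation_contradiction:
  fixes \<epsilon> \<mu> P Q R n q :: real
  assumes "0 < \<epsilon>" "0 < q" "0 < n" "0 < \<mu>" "\<mu> \<le> 1 / 10" "\<mu> \<le> q * \<epsilon> / 10"
    and P: "P \<le> n * (1 / q + \<epsilon>)" and Q: "n * (1 / q + (2 + sqrt 2) * \<epsilon>) \<le> Q"
    and R: "R \<le> n * \<epsilon>" and le: "Q - P \<le> R + \<mu> * (Q + P)"
  shows False
proof -
  define b where "b = 1 / q"
  have "(1 - \<mu>) * (n * (b + (2 + sqrt 2) * \<epsilon>)) \<le> (1 - \<mu>) * Q"
    using assms unfolding b_def by (intro mult_left_mono) auto
  also have "\<dots> \<le> (1 + \<mu>) * P + R" using le by (simp add: algebra_simps)
  also have "\<dots> \<le> (1 + \<mu>) * (n * (b + \<epsilon>)) + n * \<epsilon>"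
    using assms unfolding b_def by (intro add_mono mult_left_mono) auto
  finally have "n * ((1 - \<mu>) * (b + (2 + sqrt 2) * \<epsilon>)) \<le> n * ((1 + \<mu>) * (b + \<epsilon>) + \<epsilon>)"
    by (simp add: algebra_simps)
  then have *: "(1 - \<mu>) * (b + (2 + sqrt 2) * \<epsilon>) \<le> (1 + \<mu>) * (b + \<epsilon>) + \<epsilon>"
    using assms by simp
  have "1.4 \<le> sqrt (2::real)" by (rule real_le_rsqrt) (simp add: power2_eq_square)
  define z where "z = (1 - \<mu>) * ((2 + sqrt 2) * \<epsilon>)"
  have "(1 - \<mu>) * (3.4 * \<epsilon>) \<le> z"
    unfolding z_def using \<open>1.4 \<le> sqrt 2\<close> assms by (intro mult_left_mono mult_right_mono) auto
  then have "3.4 * \<epsilon> - 3.4 * (\<mu> * \<epsilon>) \<le> z" by (simp add: algebra_simps)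
  moreover have "(b - \<mu> * b) + z \<le> b + \<epsilon> + \<mu> * b + \<mu> * \<epsilon> + \<epsilon>"
    using * unfolding distrib_left[of "1 - \<mu>" b] z_def[symmetric] by (simp add: algebra_simps)
  moreover have "\<mu> * b \<le> \<epsilon> / 10" using assms unfolding b_def by (simp add: field_simps)
  moreover have "\<mu> * \<epsilon> \<le> \<epsilon> / 10" using assms mult_right_mono[of \<mu> "1/10" \<epsilon>] by simp
  ultimately show False using assms(1) by linarith
qed

lemma parameter_bound:
  fixes n N \<epsilon> q L :: real and M T :: nat
  assumes L: "L = 2 / \<epsilon>\<^sup>2" "16 \<le> L" and N: "2 \<le> N" and q: "0 < q" and \<epsilon>: "0 < \<epsilon>"
    and M: "2 \<le> M" "real M \<le> 2 * L" and T: "real T \<le> log 2 L + 1"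
    and n: "10^5 * log 2 N * (log 2 L)^5 / min \<epsilon> (q * \<epsilon>\<^sup>2) \<le> n"
  shows "real (Suc T) * (5 * ln N * (3 * sampling_const M * real (Suc T) / (min 1 (q * \<epsilon>) / 10)))
    \<le> n * \<epsilon>"
proof -
  define x where "x = log 2 L"
  have "4 = log 2 (2 powr 4)" by (subst log_powr_cancel) auto
  also have "\<dots> \<le> x" unfolding x_def using L by (intro log_mono) auto
  finally have x: "4 \<le> x" .
  have lnlog: "ln y \<le> log 2 y" if "1 \<le> y" for y :: real
  proof -
    have "ln y = ln 2 * log 2 y" by (simp add: log_def)
    also have "\<dots> \<le> 1 * log 2 y" using that ln_2_less_1 by (intro mult_right_mono) auto
    finally show ?thesis by simp
  qed
  have "ln (real M) \<le> log 2 (real M)" using M by (intro lnlog) auto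
  also have "\<dots> \<le> log 2 (2 * L)" using M L by (intro log_mono) auto
  also have "\<dots> = 1 + x" using L(2) by (simp add: log_mult x_def)
  finally have "ln (real M) \<le> 1 + x" .
  \<comment> \<open>From \<open>80 * (1 + x) + 16\<close> with \<open>x \<ge> 4\<close>.\<close>
  then have K: "sampling_const M \<le> 104 * x"
    unfolding sampling_const_def using x by simp
  have K0: "0 \<le> sampling_const M" by (rule sampling_const_nonneg[OF M(1)])
  have T': "real (Suc T) \<le> 2 * x" using T x unfolding x_def by simp
  have lN: "0 \<le> ln N" "ln N \<le> log 2 N" using N lnlog[of N] by auto
  define m where "m = min 1 (q * \<epsilon>)"
  have m: "0 < m" using q \<epsilon> by (simp add: m_def)
  have mm: "min \<epsilon> (q * \<epsilon>\<^sup>2) = \<epsilon> * m"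
    using \<epsilon> by (simp add: m_def min_mult_distrib_left power2_eq_square mult_ac)
  \<comment> \<open>One logarithmic factor comes from \<open>sampling_const M\<close> and two from
    the number of levels: once for adding up the levels, once because the smaller \<open>l\<close>
    raises the cost of each.\<close>
  have "real (Suc T) * (5 * ln N * (3 * sampling_const M * real (Suc T) / (m / 10)))
      = 150 * (sampling_const M * (real (Suc T) * real (Suc T)) * ln N) / m"
    by simp
  also have "\<dots> \<le> 150 * (104 * x * (2 * x * (2 * x)) * log 2 N) / m"
    using K K0 T' lN x m by (intro divide_right_mono mult_left_mono mult_mono) auto
  also have "\<dots> = 62400 * log 2 N * x ^ 3 / m" by (simp add: power3_eq_cube)
  also have "\<dots> \<le> 10^5 * log 2 N * x ^ 5 / m"
    using x lN m by (intro divide_right_mono mult_mono power_increasing) auto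
  also have "\<dots> \<le> n * \<epsilon>"
    using n \<epsilon> m unfolding mm x_def[symmetric] by (simp add: field_simps)
  finally show ?thesis unfolding m_def .
qed

subsection \<open>Codes\<close>

lemma rel_dist_agree:
  assumes "0 < n"
  shows "real (card {i \<in> {..<n}. x i = y i}) = real n * (1 - rel_dist n x y)"
proof -
  have "card {i \<in> {..<n}. x i = y i} + card {i \<in> {..<n}. x i \<noteq> y i}
      = card ({i \<in> {..<n}. x i = y i} \<union> {i \<in> {..<n}. x i \<noteq> y i})"
    by (intro card_Un_disjoint[symmetric]) auto
  also have "{i \<in> {..<n}. x i = y i} \<union> {i \<in> {..<n}. x i \<noteq> y i} = {..<n}" by auto
  finally have "real (card {i \<in> {..<n}. x i = y i}) + real (card {i \<in> {..<n}. x i \<noteq> y i}) = real n"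
    by (simp flip: of_nat_add)
  then show ?thesis using assms by (simp add: rel_dist_def right_diff_distrib)
qed

lemma list_decodableI_negative:
  assumes "\<rho> < 0" "0 \<le> l"
  shows "list_decodable F n C \<rho> l"
proof -
  have "\<not> rel_dist n z c \<le> \<rho>" for z c
    using assms unfolding rel_dist_def by (simp add: not_le order_less_le_trans[of _ 0])
  then show ?thesis using assms unfolding list_decodable_def by simp
qed

text \<open>Lets the argument speak of codewords of the original code read at the sampled columns.
  The map need not be injective: distinct codewords may become equal.\<close>

lemma row_space_sample:
  assumes "\<And>j. j < n \<Longrightarrow> J j < n'"
  shows "row_space F k n (\<lambda>i j. G i (J j)) = (\<lambda>c. \<lambda>j\<in>{..<n}. c (J j)) ` row_space F k n' G"
  unfolding row_space_def image_image
proof (intro image_cong refl)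
  fix x
  show "vec_mat F k n x (\<lambda>i j. G i (J j)) = (\<lambda>j\<in>{..<n}. vec_mat F k n' x G (J j))"
    unfolding vec_mat_def using assms by (intro restrict_ext) simp
qed

lemma row_space_subset:
  assumes "field F" and "generator_matrix F k n G C"
  shows "C \<subseteq> {..<n} \<rightarrow>\<^sub>E carrier F"
proof -
  interpret field F by fact
  have "vec_mat F k n x G \<in> {..<n} \<rightarrow>\<^sub>E carrier F" if "x \<in> carrier (vec_module F k)" for x
    unfolding vec_mat_def using that assms(2)
    by (auto simp: vec_module_def generator_matrix_def PiE_iff intro!: finsum_closed)
  then show ?thesis using assms(2) unfolding generator_matrix_def row_space_def by auto
qed

text \<open>The all-ones message is nonzero because \<open>k \<ge> 1\<close>, so its codeword
  differs from zero. The geometric series over the levels relies on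
  \<open>N \<ge> 2\<close>.\<close>

lemma two_le_card_code:
  assumes F: "field F" "finite (carrier F)" and k: "1 \<le> k" and G: "generator_matrix F k n G C"
    and code: "linear_code F n k C"
  shows "2 \<le> card C"
proof -
  interpret field F by fact
  have fin: "finite C" 
    by (rule finite_subset[OF row_space_subset[OF F(1) G]]) (intro finite_PiE, auto simp: F)
  define x where "x = (\<lambda>i\<in>{..<k}. \<one>\<^bsub>F\<^esub>)"
  have x: "x \<in> carrier (vec_module F k)" by (simp add: x_def vec_module_def)
  have "x 0 \<noteq> \<zero>\<^bsub>vec_module F k\<^esub> 0" using k by (simp add: x_def vec_module_def)
  then have "x \<noteq> \<zero>\<^bsub>vec_module F k\<^esub>" by auto
  then have ne: "vec_mat F k n x G \<noteq> \<zero>\<^bsub>vec_module F n\<^esub>" using G x unfolding generator_matrix_def by blast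
  have "vec_mat F k n x G \<in> C" using G x unfolding generator_matrix_def row_space_def by blast
  moreover have "\<zero>\<^bsub>vec_module F n\<^esub> \<in> C"
  proof -
    have "submodule C F (vec_module F n)" using code unfolding linear_code_def by simp
    then have "subgroup C (add_monoid (vec_module F n))" unfolding submodule_def by simp
    then show ?thesis using subgroup.one_closed by fastforce
  qed
  ultimately have "card {vec_mat F k n x G, \<zero>\<^bsub>vec_module F n\<^esub>} \<le> card C"
    using fin by (intro card_mono) auto
  then show ?thesis using ne by simp
qed

text \<open>Agreements with \<open>z\<close> are counted by words and by columns; in each column at
  most a plurality of the list agrees with \<open>z\<close>. This eliminates \<open>z\<close>, so no
  union bound over received words arises.\<close>

lemma undecodable_plurality:
  fixes C :: "(nat \<Rightarrow> nat) set" and J :: "nat \<Rightarrow> nat"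
  assumes n: "0 < n" and M: "0 < M"
    and many: "M \<le> card {c \<in> (\<lambda>c. \<lambda>j\<in>{..<n}. c (J j)) ` C. rel_dist n z c \<le> \<rho>}"
  obtains \<sigma> where "\<sigma> \<in> {..<M} \<rightarrow>\<^sub>E C" "inj_on \<sigma> {..<M}"
    "real n * (1 - \<rho>) \<le> (\<Sum>j<n. plurality_frac M \<sigma> (J j))"
proof -
  define s where "s c = (\<lambda>j\<in>{..<n}. c (J j))" for c :: "nat \<Rightarrow> nat"
  obtain B where B: "B \<subseteq> {c \<in> s ` C. rel_dist n z c \<le> \<rho>}" "card B = M" "finite B"
    using obtain_subset_with_card_n[OF many] unfolding s_def[abs_def] by auto
  obtain e where e: "bij_betw e {..<M} B"
    using ex_bij_betw_nat_finite[OF B(3)] B(2) by (auto simp: atLeast0LessThan)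
  have eB: "e i \<in> s ` C" "rel_dist n z (e i) \<le> \<rho>" if "i < M" for i
    using bij_betwE[OF e] B(1) that by auto
  \<comment> \<open>One preimage is chosen for each sampled word; the preimages are distinct because
    the sampled words are.\<close>
  define \<sigma> where "\<sigma> = (\<lambda>i\<in>{..<M}. inv_into C s (e i))"
  have \<sigma>: "\<sigma> i \<in> C" "s (\<sigma> i) = e i" if "i < M" for i
    using inv_into_into[OF eB(1)[OF that]] f_inv_into_f[OF eB(1)[OF that]] that by (simp_all add: \<sigma>_def)
  show thesis
  proof (rule that[of \<sigma>])
    show "\<sigma> \<in> {..<M} \<rightarrow>\<^sub>E C" using \<sigma> by (auto simp: \<sigma>_def)
    show "inj_on \<sigma> {..<M}"
    proof (rule inj_onI)
      fix i j assume ij: "i \<in> {..<M}" "j \<in> {..<M}" "\<sigma> i = \<sigma> j"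
      then have "e i = e j" using \<sigma>(2)[of i] \<sigma>(2)[of j] by simp
      then show "i = j" using ij e unfolding bij_betw_def inj_on_def by blast
    qed
    have "real M * (real n * (1 - \<rho>)) \<le> (\<Sum>i<M. real (card {j \<in> {..<n}. \<sigma> i (J j) = z j}))"
    proof -
      have "real n * (1 - \<rho>) \<le> real (card {j \<in> {..<n}. \<sigma> i (J j) = z j})" if "i < M" for i
      proof -
        have "{j \<in> {..<n}. \<sigma> i (J j) = z j} = {j \<in> {..<n}. z j = e i j}"
          unfolding \<sigma>(2)[OF that, symmetric] s_def by auto
        then show ?thesis
          using rel_dist_agree[OF n, of z "e i"] eB(2)[OF that] by (simp add: mult_left_mono)
      qed
      then show ?thesis using sum_mono[of "{..<M}" "\<lambda>_. real n * (1 - \<rho>)"] by simp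
    qed
    also have "\<dots> = (\<Sum>j<n. real (card {i \<in> {..<M}. \<sigma> i (J j) = z j}))"
    proof -
      have "(\<Sum>i<M. real (card {j \<in> {..<n}. \<sigma> i (J j) = z j})) = (\<Sum>i<M. \<Sum>j<n. of_bool (\<sigma> i (J j) = z j))"
        by (simp add: Int_def)
      also have "\<dots> = (\<Sum>j<n. \<Sum>i<M. of_bool (\<sigma> i (J j) = z j))" by (rule sum.swap)
      finally show ?thesis by (simp add: Int_def)
    qed
    also have "\<dots> \<le> (\<Sum>j<n. real (plurality M (\<lambda>i. \<sigma> i (J j))))"
      using card_le_plurality[OF M] by (intro sum_mono) simp
    also have "\<dots> = real M * (\<Sum>j<n. plurality_frac M \<sigma> (J j))"
      using M by (simp add: plurality_frac_def sum_distrib_left)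
    finally show "real n * (1 - \<rho>) \<le> (\<Sum>j<n. plurality_frac M \<sigma> (J j))" using M by simp
  qed
qed

theorem corollary1:
  shows "\<exists>C\<^sub>0 p :: real. C\<^sub>0 > 0 \<and> p > 0 \<and>
    (\<forall>(\<epsilon> :: real) (F :: nat ring) (q :: nat) (n' :: nat) (k :: nat)
        (C' :: (nat \<Rightarrow> nat) set) (G' :: nat \<Rightarrow> nat \<Rightarrow> nat) (N :: real) (L :: real)
        (n :: nat) (\<epsilon>' :: real).
       \<epsilon> > 0 \<longrightarrow>
       field F \<longrightarrow> finite (carrier F) \<longrightarrow> q = card (carrier F) \<longrightarrow>
       k \<ge> 1 \<longrightarrow> linear_code F n' k C' \<longrightarrow> generator_matrix F k n' G' C' \<longrightarrow>
       code_rel_dist n' C' \<ge> 1 - 1 / real q - \<epsilon>^2 / 2 \<longrightarrow>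
       N = real (card C') \<longrightarrow> L = 2 / \<epsilon>^2 \<longrightarrow>
       n > 0 \<longrightarrow>
       real n \<ge> C\<^sub>0 * log 2 N * (log 2 L)^5 / min \<epsilon> (real q * \<epsilon>^2) \<longrightarrow>
       \<epsilon>' = (2 + sqrt 2) * \<epsilon> \<longrightarrow>
       measure_pmf.prob (sampled_code F k n' G' n)
         {C. list_decodable F n C (1 - 1 / real q - \<epsilon>') (2 / \<epsilon>^2)} \<ge> p)"
\<comment> \<open>\<open>1/2\<close> is the probability from
  \<open>uniform_plurality_deviation\<close>; \<open>10^5\<close> exceeds the factor 62400 arising
  in \<open>parameter_bound\<close>.\<close>
proof (rule exI[of _ "10^5"], rule exI[of _ "1/2"], intro conjI allI impI)
  fix \<epsilon> :: real and F :: "nat ring" and q n' k :: nat and C' :: "(nat \<Rightarrow> nat) set"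
    and G' :: "nat \<Rightarrow> nat \<Rightarrow> nat" and N L :: real and n :: nat and \<epsilon>' :: real
  assume \<epsilon>: "\<epsilon> > 0" and F: "field F" "finite (carrier F)" and q: "q = card (carrier F)"
    and k: "k \<ge> 1" and code: "linear_code F n' k C'" and G: "generator_matrix F k n' G' C'"
    and dist: "code_rel_dist n' C' \<ge> 1 - 1 / real q - \<epsilon>^2 / 2"
    and N: "N = real (card C')" and L: "L = 2 / \<epsilon>^2" and n: "n > 0"
    and nge: "real n \<ge> 10^5 * log 2 N * (log 2 L)^5 / min \<epsilon> (real q * \<epsilon>^2)"
    and \<epsilon>': "\<epsilon>' = (2 + sqrt 2) * \<epsilon>"
  interpret field F by (rule F)
  have ne: "carrier F \<noteq> {}" by auto
  then have q0: "0 < q" using q F(2) by (simp add: card_gt_0_iff)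
  define p where "p = pmf_of_set {..<n'}"
  define P where "P = Pi_pmf {..<n} (0::nat) (\<lambda>_. p)"
  define \<rho> where "\<rho> = 1 - 1 / real q - \<epsilon>'"
  have prob: "measure_pmf.prob (sampled_code F k n' G' n) {C. list_decodable F n C \<rho> (2 / \<epsilon>^2)}
      = measure_pmf.prob P {J. list_decodable F n (row_space F k n (\<lambda>i j. G' i (J j))) \<rho> (2 / \<epsilon>^2)}"
    unfolding sampled_code_def P_def p_def measure_map_pmf vimage_def by simp
  have "1 / 2 \<le> measure_pmf.prob P {J. list_decodable F n (row_space F k n (\<lambda>i j. G' i (J j))) \<rho> (2 / \<epsilon>^2)}"
  proof (cases "\<rho> < 0")
    case True
    then have "{J. list_decodable F n (row_space F k n (\<lambda>i j. G' i (J j))) \<rho> (2 / \<epsilon>^2)} = UNIV"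
      using \<epsilon> by (auto intro: list_decodableI_negative)
    then show ?thesis by simp
  next
    case False
    \<comment> \<open>A nonnegative radius forces \<open>3.4 * \<epsilon> < 1\<close>, so that
      \<open>L\<close> is bounded below and its logarithm dominates the additive constants.\<close>
    have "1.4 \<le> sqrt (2::real)" by (rule real_le_rsqrt) (simp add: power2_eq_square)
    then have "3.4 * \<epsilon> \<le> \<epsilon>'" unfolding \<epsilon>' using \<epsilon> by (intro mult_right_mono) auto
    moreover have "\<epsilon>' < 1" using False q0 unfolding \<rho>_def by (smt (verit) divide_pos_pos of_nat_0_less_iff)
    ultimately have "\<epsilon> \<le> 1 / 3" by simp
    then have "\<epsilon> * \<epsilon> \<le> 1 / 3 * (1 / 3)" using \<epsilon> by (intro mult_mono) auto
    then have e2: "\<epsilon>\<^sup>2 \<le> 1 / 9" by (simp add: power2_eq_square)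
    then have L16: "16 \<le> L" unfolding L using \<epsilon> by (simp add: pos_le_divide_eq)
    \<comment> \<open>The least integer above \<open>L\<close>: a list that is too long has at least
      \<open>M\<close> words.\<close>
    define M where "M = nat \<lfloor>L\<rfloor> + 1"
    have M: "2 \<le> M" "L < real M" "real M \<le> 2 * L"
      using L16 unfolding M_def by linarith+
    define T where "T = nat \<lceil>log 2 L\<rceil>"
    have log0: "0 \<le> log 2 L" using L16 by simp
    have T: "real T \<le> log 2 L + 1" unfolding T_def using log0 by linarith
    have MT: "M \<le> 2 ^ Suc T"
    proof -
      have "L = 2 powr log 2 L" using L16 by simp
      also have "\<dots> \<le> 2 powr real T" unfolding T_def by (intro powr_mono) (use log0 in linarith, simp)
      also have "\<dots> = 2 ^ T" by (simp add: powr_realpow)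
      finally have "real M \<le> real (2 ^ Suc T)" using M(3) by simp
      then show ?thesis by (simp only: of_nat_le_iff)
    qed
    note sub = row_space_subset[OF F(1) G]
    have finC: "finite C'" by (rule finite_subset[OF sub]) (intro finite_PiE, auto simp: F)
    have C2: "2 \<le> card C'" by (rule two_le_card_code[OF F k G code])
    \<comment> \<open>For length 0 there is only one word. Positivity is what makes
      \<open>pmf_of_set {..<n'}\<close> a genuine uniform distribution.\<close>
    have n'0: "0 < n'"
    proof (rule ccontr)
      assume "\<not> 0 < n'"
      then have "card C' \<le> card {\<lambda>_::nat. undefined :: nat}" using sub by (intro card_mono) auto
      then show False using C2 by simp
    qed
    have sp: "set_pmf p = {..<n'}" unfolding p_def using n'0 by (simp add: lessThan_empty_iff)
    have finp: "finite (set_pmf p)" by (simp add: sp)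
    define \<mu> where "\<mu> = min 1 (real q * \<epsilon>) / 10"
    have \<mu>: "0 < \<mu>" "\<mu> \<le> 1 / 10" "\<mu> \<le> real q * \<epsilon> / 10"
      using q0 \<epsilon> by (auto simp: \<mu>_def)
    define K where "K = sampling_const M"
    have K: "0 < K"
      unfolding K_def sampling_const_def using M(1) by (intro add_nonneg_pos mult_nonneg_nonneg ln_ge_zero) auto
    \<comment> \<open>Chosen so that the coefficient of \<open>S + E\<close>, summed over the
      \<open>Suc T\<close> levels, is exactly \<open>\<mu>\<close>.\<close>
    define l where "l = \<mu> / (3 * K * real (Suc T))"
    have l: "0 < l" using \<mu> K by (simp add: l_def)
    define R where "R = real (Suc T) * (5 * ln N / l)"
    have R: "R \<le> real n * \<epsilon>"
    proof -
      have "R = real (Suc T) * (5 * ln N * (3 * K * real (Suc T) / \<mu>))"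
        by (simp add: R_def l_def)
      also have "\<dots> \<le> real n * \<epsilon>"
        unfolding K_def \<mu>_def using C2 q0 by (intro parameter_bound[OF L L16 _ _ \<epsilon> M(1,3) T nge]) (auto simp: N)
      finally show ?thesis .
    qed
    define good where "good = {J. \<forall>\<sigma>\<in>{..<M} \<rightarrow>\<^sub>E C'.
      (\<Sum>j<n. plurality_frac M \<sigma> (J j)) - real n * measure_pmf.expectation p (plurality_frac M \<sigma>)
      \<le> real (Suc T) * (5 * ln (real (card C')) / l + 3 * sampling_const M * l *
          ((\<Sum>j<n. plurality_frac M \<sigma> (J j)) + real n * measure_pmf.expectation p (plurality_frac M \<sigma>)))}"
    have "1 / 2 \<le> measure_pmf.prob P good"
      unfolding P_def good_def by (rule uniform_plurality_deviation[OF finp finC C2 M(1) MT l])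
    \<comment> \<open>On the support of \<open>P\<close> all sampled indices are below
      \<open>n'\<close>, as \<open>row_space_sample\<close> requires.\<close>
    also have "\<dots> = measure_pmf.prob P (good \<inter> set_pmf P)" by (simp add: measure_Int_set_pmf)
    also have "\<dots> \<le> measure_pmf.prob P {J. list_decodable F n (row_space F k n (\<lambda>i j. G' i (J j))) \<rho> (2 / \<epsilon>^2)}"
    proof (intro measure_pmf.finite_measure_mono subsetI CollectI)
      fix J assume J: "J \<in> good \<inter> set_pmf P"
      have Jn: "J j < n'" if "j < n" for j
        using J that unfolding P_def by (auto simp: set_Pi_pmf sp PiE_dflt_def)
      have rs: "row_space F k n (\<lambda>i j. G' i (J j)) = (\<lambda>c. \<lambda>j\<in>{..<n}. c (J j)) ` C'"
        using row_space_sample[OF Jn] G unfolding generator_matrix_def by simp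
      show "list_decodable F n (row_space F k n (\<lambda>i j. G' i (J j))) \<rho> (2 / \<epsilon>^2)"
        unfolding rs list_decodable_def
      proof (intro ballI, rule ccontr)
        fix z
        assume "\<not> real (card {c \<in> (\<lambda>c. \<lambda>j\<in>{..<n}. c (J j)) ` C'. rel_dist n z c \<le> \<rho>}) \<le> 2 / \<epsilon>\<^sup>2"
        then have "L < real (card {c \<in> (\<lambda>c. \<lambda>j\<in>{..<n}. c (J j)) ` C'. rel_dist n z c \<le> \<rho>})"
          by (simp add: L)
        then have many: "M \<le> card {c \<in> (\<lambda>c. \<lambda>j\<in>{..<n}. c (J j)) ` C'. rel_dist n z c \<le> \<rho>}"
          unfolding M_def using L16 by linarith
        have M0: "0 < M" using M by simp
        obtain \<sigma> where \<sigma>: "\<sigma> \<in> {..<M} \<rightarrow>\<^sub>E C'" "inj_on \<sigma> {..<M}"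
          and Q: "real n * (1 - \<rho>) \<le> (\<Sum>j<n. plurality_frac M \<sigma> (J j))"
          using undecodable_plurality[OF n M0 many] .
        have agr: "measure_pmf.prob p {u. \<sigma> i u = \<sigma> j u} \<le> 1 / real (card (carrier F)) + \<epsilon>\<^sup>2 / 2"
          if ij: "i < M" "j < M" "i \<noteq> j" for i j
        proof -
          have "\<sigma> i \<noteq> \<sigma> j" using \<sigma>(2) ij by (auto simp: inj_on_def)
          moreover have "\<sigma> i \<in> C'" "\<sigma> j \<in> C'" using \<sigma>(1) ij by auto
          moreover have "finite {rel_dist n' x y | x y. x \<in> C' \<and> y \<in> C' \<and> x \<noteq> y}"
            by (rule finite_subset[of _ "(\<lambda>(x, y). rel_dist n' x y) ` (C' \<times> C')"]) (use finC in auto)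
          ultimately have "code_rel_dist n' C' \<le> rel_dist n' (\<sigma> i) (\<sigma> j)"
            unfolding code_rel_dist_def by (intro Min_le) auto
          moreover have "measure_pmf.prob p {u. \<sigma> i u = \<sigma> j u} = 1 - rel_dist n' (\<sigma> i) (\<sigma> j)"
          proof -
            have "measure_pmf.prob p {u. \<sigma> i u = \<sigma> j u} = real (card {u \<in> {..<n'}. \<sigma> i u = \<sigma> j u}) / real n'"
              unfolding p_def using n'0 by (simp add: measure_pmf_of_set lessThan_empty_iff Int_def)
            then show ?thesis using rel_dist_agree[OF n'0, of "\<sigma> i" "\<sigma> j"] n'0 by simp
          qed
          ultimately show ?thesis using dist q by simp
        qed
        have mean: "measure_pmf.expectation p (plurality_frac M \<sigma>) \<le> 1 / real (card (carrier F)) + \<epsilon>"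
        proof (rule expectation_plurality_frac_le[OF finp M0 F(2) ne _ agr])
          show "\<sigma> i u \<in> carrier F" if "i < M" "u \<in> set_pmf p" for i u
            using \<sigma>(1) sub that unfolding sp by (auto simp: PiE_iff subset_iff)
          have "1 / real M \<le> 1 / L" using M L16 by (intro divide_left_mono) auto
          then show "1 / real M + \<epsilon>\<^sup>2 / 2 \<le> \<epsilon>\<^sup>2" by (simp add: L)
        qed (use \<epsilon> in auto)
        define S where "S = (\<Sum>j<n. plurality_frac M \<sigma> (J j))"
        define E where "E = real n * measure_pmf.expectation p (plurality_frac M \<sigma>)"
        have "S - E \<le> real (Suc T) * (5 * ln N / l + 3 * K * l * (S + E))"
          using J \<sigma>(1) unfolding good_def S_def E_def K_def N by blast
        also have "\<dots> = R + \<mu> * (S + E)"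
        proof -
          have "real (Suc T) * (3 * K * l) = \<mu>" using K unfolding l_def by (simp del: of_nat_Suc)
          then show ?thesis unfolding R_def by (simp only: distrib_left mult.assoc[symmetric])
        qed
        finally have le: "S - E \<le> R + \<mu> * (S + E)" .
        show False
        proof (rule deviation_contradiction[OF \<epsilon> _ _ \<mu> _ _ R le])
          show "E \<le> real n * (1 / real q + \<epsilon>)"
            unfolding E_def q using mean by (intro mult_left_mono) auto
          show "real n * (1 / real q + (2 + sqrt 2) * \<epsilon>) \<le> S"
            using Q unfolding S_def \<rho>_def \<epsilon>' by simp
        qed (use q0 n in simp_all)
      qed
    qed simp
    finally show ?thesis .
  qed
  then show "measure_pmf.prob (sampled_code F k n' G' n)
      {C. list_decodable F n C (1 - 1 / real q - \<epsilon>') (2 / \<epsilon>^2)} \<ge> 1 / 2"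
    using prob unfolding \<rho>_def by simp
qed simp_all

end
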